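(* Consider the Cox model counting process setting of the context. Let $\xi>1$, let $\lambda\ge0$ be the penalty level, and let $\hat{\beta}$ be the lasso estimator, i.e. a minimizer over $\beta\in\mathbb{R}^p$ of $\ell(\beta)+\lambda|\beta|_1$. Let $\kappa(\xi,\mathcal{O})=\kappa(\xi,\mathcal{O};\ddot\ell(\beta^o))$, $F_q(\xi,\mathcal{O})=F_q(\xi,\mathcal{O};\ddot\ell(\beta^o))$, and $$\tau=\frac{K(\xi+1)d_o\lambda}{2\kappa^2(\xi,\mathcal{O})}$$ with a certain $K>0$. Suppose $$\max_{i<i'\le n}\ \sup_{0\le t<\infty}\ \max_{j\le p}|Z_{i,j}(t)-Z_{i',j}(t)|\le K$$ and $\tau\le 1/e$. Then, in the event $|\dot\ell(\beta^o)|_\infty\le \frac{\xi-1}{\xi+1}\lambda$, $$D^s(\hat\beta,\beta^o)\le\frac{4e^{\eta}(1+1/\xi)^{-2}\lambda^2d_o}{\kappa^2(\xi,\mathcal{O})},\qquad |\hat\beta-\beta^o|_1\le\frac{e^{\eta}(\xi+1)d_o\lambda}{2\kappa^2(\xi,\mathcal{O})},$$ and $$|\hat\beta-\beta^o|_q\le\frac{2e^{\eta}(1+1/\xi)^{-1}d_o^{1/q}\lambda}{F_q(\xi,\mathcal{O})},\qquad q\ge1,$$ where $\eta\le 1$ is the smaller solution of $\eta e^{-\eta}=\tau$.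
   Context: Cox model. Let $N_1,\dots,N_n$ be counting processes on $[0,\infty)$ (sample paths are step functions, zero at $t=0$, with jumps of size $+1$ only, no two components jumping at the same time), adapted to a filtration $\{\mathcal{F}_t\}$. Let $Y_i(t)\in\{0,1\}$ be predictable at-risk indicator processes and $Z_i(t)=(Z_{i,1}(t),\dots,Z_{i,p}(t))'\in\mathbb{R}^p$ predictable covariate processes. Assume $N_i$ has predictable compensator $\Lambda_i$ with $d\Lambda_i(t)=Y_i(t)\exp\{Z_i'(t)\beta^o\}\,d\Lambda_0(t)$, where $\beta^o\in\mathbb{R}^p$ is the vector of true regression coefficients and $\Lambda_0$ is an unknown baseline cumulative hazard function. Write $\bar N=\sum_{i=1}^nN_i$. Negative log-partial likelihood (divided by $n$): $$\ell(\beta)=-\frac1n\Big\{\sum_{i=1}^n\int_0^\infty Z_i'(s)\beta\,dN_i(s)-\int_0^\infty\log\Big[\sum_{i=1}^nY_i(s)e^{Z_i'(s)\beta}\Big]d\bar N(s)\Big\}.$$ $\dot\ell(\beta)$ and $\ddot\ell(\beta)$ denote its gradient and Hessian. Explicitly, with $w_{ni}(t,\beta)=Y_i(t)e^{Z_i'(t)\beta}/\sum_kY_k(t)e^{Z_k'(t)\beta}$, $\bar Z_n(t,\beta)=\sum_iw_{ni}(t,\beta)Z_i(t)$ and $V_n(t,\beta)=\sum_iw_{ni}(t,\beta)(Z_i(t)-\bar Z_n(t,\beta))(Z_i(t)-\bar Z_n(t,\beta))'$, one has $\dot\ell(\beta)=-\frac1n\sum_i\int_0^\infty[Z_i(s)-\bar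 Z_n(s,\beta)]dN_i(s)$ and $\ddot\ell(\beta)=\frac1n\int_0^\infty V_n(s,\beta)\,d\bar N(s)$. Norms: $|v|_q=(\sum_j|v_j|^q)^{1/q}$ for $1\le q<\infty$, $|v|_\infty=\max_j|v_j|$. Symmetric Bregman divergence: $D^s(b,\beta)=(b-\beta)'(\dot\ell(b)-\dot\ell(\beta))$. Sparsity: $\mathcal{O}=\{j:\beta^o_j\ne0\}$, $\mathcal{O}^c=\{j:\beta_j^o=0\}$, $d_o=|\mathcal{O}|$; $b_{\mathcal{O}},b_{\mathcal{O}^c}$ denote subvectors. Cone: $\mathscr{C}(\xi,\mathcal{O})=\{b\in\mathbb{R}^p:|b_{\mathcal{O}^c}|_1\le\xi|b_{\mathcal{O}}|_1\}$. For a $p\times p$ nonnegative-definite matrix $\bar\Sigma$, the compatibility factor and weak cone invertibility factor are $$\kappa(\xi,\mathcal{O};\bar\Sigma)=\inf_{0\ne b\in\mathscr{C}(\xi,\mathcal{O})}\frac{d_o^{1/2}(b'\bar\Sigma b)^{1/2}}{|b_{\mathcal{O}}|_1},\qquad F_q(\xi,\mathcal{O};\bar\Sigma)=\inf_{0\ne b\in\mathscr{C}(\xi,\mathcal{O})}\frac{d_o^{1/q}\,b'\bar\Sigma b}{|b_{\mathcal{O}}|_1|b|_q}.$$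
   Formalization: The bounds on the 1-norm and q-norm of the estimation error are stated only for λ > 0, since at λ = 0 the minimizer need not be unique and they can fail; the bound on D^s is stated for all λ ≥ 0. *)

theory Defs
  imports "HOL-Probability.Probability"
begin

section \<open>Processes\<close>

text \<open>Processes are indexed by real time, and only their values at times \<open>t \<ge> 0\<close> are used.
  A filtration \<open>(F t)\<close>, \<open>t \<ge> 0\<close>, is extended to negative times in an arbitrary monotone way (for
  instance by \<open>F 0\<close>) in order to fit the library locale \<^locale>\<open>filtration\<close>.\<close>

definition adapted :: "(real \<Rightarrow> 'w measure) \<Rightarrow> (real \<Rightarrow> 'w \<Rightarrow> real) \<Rightarrow> bool" where
  "adapted F X \<longleftrightarrow> (\<forall>t\<ge>0. X t \<in> borel_measurable (F t))"

definition predictable_sigma :: "'w measure \<Rightarrow> (real \<Rightarrow> 'w measure) \<Rightarrow> (real \<times> 'w) measure" where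
  "predictable_sigma M F = sigma ({0..} \<times> space M)
     ({{0} \<times> A | A. A \<in> sets (F 0)} \<union>
      {{s<..t} \<times> A | s t A. 0 \<le> s \<and> s < t \<and> A \<in> sets (F s)})"

definition predictable ::
    "'w measure \<Rightarrow> (real \<Rightarrow> 'w measure) \<Rightarrow> (real \<Rightarrow> 'w \<Rightarrow> 'b::topological_space) \<Rightarrow> bool" where
  "predictable M F X \<longleftrightarrow> (\<lambda>(t, \<omega>). X t \<omega>) \<in> borel_measurable (predictable_sigma M F)"

definition martingale ::
    "'w measure \<Rightarrow> (real \<Rightarrow> 'w measure) \<Rightarrow> (real \<Rightarrow> 'w \<Rightarrow> real) \<Rightarrow> bool" where
  "martingale M F X \<longleftrightarrow> adapted F X \<and> (\<forall>t\<ge>0. integrable M (X t)) \<and>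
     (\<forall>s t. 0 \<le> s \<and> s \<le> t \<longrightarrow> (AE \<omega> in M. real_cond_exp M (F s) (X t) \<omega> = X s \<omega>))"

text \<open>The localizing times may be taken finite: replace \<open>T k\<close> by \<open>min (T k) k\<close>.\<close>

definition local_martingale ::
    "'w measure \<Rightarrow> (real \<Rightarrow> 'w measure) \<Rightarrow> (real \<Rightarrow> 'w \<Rightarrow> real) \<Rightarrow> bool" where
  "local_martingale M F X \<longleftrightarrow> (\<exists>T :: nat \<Rightarrow> 'w \<Rightarrow> real.
     (\<forall>k. stopping_time F (T k)) \<and> (\<forall>k. \<forall>\<omega>\<in>space M. 0 \<le> T k \<omega>) \<and>
     (AE \<omega> in M. incseq (\<lambda>k. T k \<omega>) \<and> filterlim (\<lambda>k. T k \<omega>) at_top sequentially) \<and>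
     (\<forall>k. martingale M F (\<lambda>t \<omega>. X (min t (T k \<omega>)) \<omega> - X 0 \<omega>)))"

definition cadlag_increasing :: "(real \<Rightarrow> real) \<Rightarrow> bool" where
  "cadlag_increasing f \<longleftrightarrow> f 0 = 0 \<and> mono_on {0..} f \<and> (\<forall>t\<ge>0. continuous (at_right t) f)"

definition jump :: "(real \<Rightarrow> real) \<Rightarrow> real \<Rightarrow> real" where
  "jump f t = f t - Lim (at_left t) f"

text \<open>A right-continuous nondecreasing function with values in the natural numbers is a step
  function with finitely many steps in each bounded interval.\<close>

definition counting_path :: "(real \<Rightarrow> real) \<Rightarrow> bool" where
  "counting_path f \<longleftrightarrow> cadlag_increasing f \<and> (\<forall>t\<ge>0. f t \<in> \<nat>) \<and> (\<forall>t>0. jump f t \<in> {0, 1})"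

definition compensator ::
    "'w measure \<Rightarrow> (real \<Rightarrow> 'w measure) \<Rightarrow> (real \<Rightarrow> 'w \<Rightarrow> real) \<Rightarrow> (real \<Rightarrow> 'w \<Rightarrow> real) \<Rightarrow> bool" where
  "compensator M F N L \<longleftrightarrow> predictable M F L \<and>
     (\<forall>\<omega>\<in>space M. cadlag_increasing (\<lambda>t. L t \<omega>)) \<and>
     local_martingale M F (\<lambda>t \<omega>. N t \<omega> - L t \<omega>)"

text \<open>Lebesgue-Stieltjes measure of a function on \<open>{0..}\<close>; the constant extension to the left
  puts no mass on \<open>{..0}\<close>.\<close>

definition stieltjes :: "(real \<Rightarrow> real) \<Rightarrow> real measure" where
  "stieltjes f = interval_measure (\<lambda>t. f (max 0 t))"


section \<open>The Cox model\<close>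

locale cox_model = prob_space M + filtration "space M" F
  for M :: "'w measure" and F :: "real \<Rightarrow> 'w measure" +
  fixes n :: nat
    and N :: "nat \<Rightarrow> real \<Rightarrow> 'w \<Rightarrow> real"
    and Y :: "nat \<Rightarrow> real \<Rightarrow> 'w \<Rightarrow> real"
    and Z :: "nat \<Rightarrow> real \<Rightarrow> 'w \<Rightarrow> real^'p"
    and \<Lambda> :: "nat \<Rightarrow> real \<Rightarrow> 'w \<Rightarrow> real"
    and \<Lambda>0 :: "real \<Rightarrow> real"
    and \<beta>o :: "real^'p"
  assumes n_pos: "n \<ge> 1"
    and subalg: "\<And>t. subalgebra M (F t)"
    and N_adapted: "\<And>i. i \<in> {1..n} \<Longrightarrow> adapted F (N i)"
    and N_counting: "\<And>i \<omega>. i \<in> {1..n} \<Longrightarrow> \<omega> \<in> space M \<Longrightarrow> counting_path (\<lambda>t. N i t \<omega>)"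
    and no_common_jumps:
      "\<And>i i' t \<omega>. i \<in> {1..n} \<Longrightarrow> i' \<in> {1..n} \<Longrightarrow> i \<noteq> i' \<Longrightarrow> \<omega> \<in> space M \<Longrightarrow> 0 < t \<Longrightarrow>
         jump (\<lambda>s. N i s \<omega>) t = 0 \<or> jump (\<lambda>s. N i' s \<omega>) t = 0"
    and Y_predictable: "\<And>i. i \<in> {1..n} \<Longrightarrow> predictable M F (Y i)"
    and Y_indicator: "\<And>i t \<omega>. i \<in> {1..n} \<Longrightarrow> 0 \<le> t \<Longrightarrow> \<omega> \<in> space M \<Longrightarrow> Y i t \<omega> \<in> {0, 1}"
    and Z_predictable: "\<And>i. i \<in> {1..n} \<Longrightarrow> predictable M F (Z i)"
    and baseline: "cadlag_increasing \<Lambda>0"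
    and N_compensator: "\<And>i. i \<in> {1..n} \<Longrightarrow> compensator M F (N i) (\<Lambda> i)"
    and intensity: "\<And>i. i \<in> {1..n} \<Longrightarrow> AE \<omega> in M. \<forall>t\<ge>0.
         set_integrable (stieltjes \<Lambda>0) {0..t} (\<lambda>s. Y i s \<omega> * exp (Z i s \<omega> \<bullet> \<beta>o)) \<and>
         \<Lambda> i t \<omega> = (LINT s:{0..t}|stieltjes \<Lambda>0. Y i s \<omega> * exp (Z i s \<omega> \<bullet> \<beta>o))"

text \<open>The negative log-partial likelihood, divided by \<open>n\<close>, on the sample point \<open>\<omega>\<close>. At a time when
  nobody is at risk the convention \<open>ln 0 = 0\<close> applies; by the form of the compensators, almost
  surely no jump occurs at such a time.\<close>

definition neg_log_pl ::
    "nat \<Rightarrow> (nat \<Rightarrow> real \<Rightarrow> 'w \<Rightarrow> real) \<Rightarrow> (nat \<Rightarrow> real \<Rightarrow> 'w \<Rightarrow> real) \<Rightarrow>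
     (nat \<Rightarrow> real \<Rightarrow> 'w \<Rightarrow> real^'p) \<Rightarrow> 'w \<Rightarrow> real^'p \<Rightarrow> real" where
  "neg_log_pl n N Y Z \<omega> \<beta> = - (1 / real n) *
     ((\<Sum>i=1..n. LINT s:{0..}|stieltjes (\<lambda>t. N i t \<omega>). Z i s \<omega> \<bullet> \<beta>) -
      (LINT s:{0..}|stieltjes (\<lambda>t. \<Sum>i=1..n. N i t \<omega>).
         ln (\<Sum>i=1..n. Y i s \<omega> * exp (Z i s \<omega> \<bullet> \<beta>))))"

text \<open>Existence of the integrals above. It holds in particular if the total number of jumps on
  the path is finite; otherwise the library integral would silently return 0.\<close>

definition neg_log_pl_exists ::
    "nat \<Rightarrow> (nat \<Rightarrow> real \<Rightarrow> 'w \<Rightarrow> real) \<Rightarrow> (nat \<Rightarrow> real \<Rightarrow> 'w \<Rightarrow> real) \<Rightarrow>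
     (nat \<Rightarrow> real \<Rightarrow> 'w \<Rightarrow> real^'p) \<Rightarrow> 'w \<Rightarrow> bool" where
  "neg_log_pl_exists n N Y Z \<omega> \<longleftrightarrow> (\<forall>\<beta>.
     (\<forall>i\<in>{1..n}. set_integrable (stieltjes (\<lambda>t. N i t \<omega>)) {0..} (\<lambda>s. Z i s \<omega> \<bullet> \<beta>)) \<and>
     set_integrable (stieltjes (\<lambda>t. \<Sum>i=1..n. N i t \<omega>)) {0..}
       (\<lambda>s. ln (\<Sum>i=1..n. Y i s \<omega> * exp (Z i s \<omega> \<bullet> \<beta>))))"

definition gradient :: "(real^'p \<Rightarrow> real) \<Rightarrow> real^'p \<Rightarrow> real^'p" where
  "gradient f x = (THE g. GDERIV f x :> g)"

definition hessian :: "(real^'p \<Rightarrow> real) \<Rightarrow> real^'p \<Rightarrow> real^'p^'p" where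
  "hessian f x = matrix (frechet_derivative (gradient f) (at x))"

definition sym_bregman :: "(real^'p \<Rightarrow> real) \<Rightarrow> real^'p \<Rightarrow> real^'p \<Rightarrow> real" where
  "sym_bregman f b \<beta> = (b - \<beta>) \<bullet> (gradient f b - gradient f \<beta>)"


section \<open>Norms, cone, compatibility and cone invertibility factors\<close>

definition lq_norm :: "ereal \<Rightarrow> real^'p \<Rightarrow> real" where
  "lq_norm q v = (if q = \<infinity> then Max (range (\<lambda>j. \<bar>v $ j\<bar>))
     else (\<Sum>j\<in>UNIV. \<bar>v $ j\<bar> powr real_of_ereal q) powr (1 / real_of_ereal q))"

definition lasso_estimator :: "(real^'p \<Rightarrow> real) \<Rightarrow> real \<Rightarrow> real^'p \<Rightarrow> bool" where
  "lasso_estimator f lam b \<longleftrightarrow> is_arg_min (\<lambda>\<beta>. f \<beta> + lam * lq_norm 1 \<beta>) (\<lambda>_. True) b"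

definition support :: "real^'p \<Rightarrow> 'p set" where
  "support \<beta> = {j. \<beta> $ j \<noteq> 0}"

text \<open>The subvector of \<open>v\<close> with index set \<open>A\<close>, padded with zeros; the padding does not affect
  its \<open>l\<^sub>q\<close> norms.\<close>

definition subvec :: "'p set \<Rightarrow> real^'p \<Rightarrow> real^'p" where
  "subvec A v = (\<chi> j. if j \<in> A then v $ j else 0)"

definition cone_set :: "real \<Rightarrow> 'p set \<Rightarrow> (real^'p) set" where
  "cone_set \<xi> A = {b. lq_norm 1 (subvec (- A) b) \<le> \<xi> * lq_norm 1 (subvec A b)}"

text \<open>The infima are taken in the extended reals, so that they are \<open>\<infinity>\<close> when the cone is trivial,
  that is, when \<open>A = {}\<close>. On nonzero elements of the cone the denominators are positive
  (for \<open>\<xi> \<ge> 0\<close>). In \<^typ>\<open>ereal\<close>, \<open>x / 0 = \<infinity>\<close> for \<open>x > 0\<close>, \<open>0 / 0 = 0\<close>, and \<open>x / \<infinity> = 0\<close>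
  for real \<open>x\<close>.\<close>

definition compat_factor :: "real \<Rightarrow> 'p set \<Rightarrow> real^'p^'p \<Rightarrow> ereal" where
  "compat_factor \<xi> A S = (INF b \<in> {b \<in> cone_set \<xi> A. b \<noteq> 0}.
     ereal (sqrt (real (card A)) * sqrt (b \<bullet> (S *v b)) / lq_norm 1 (subvec A b)))"

definition weak_cif :: "ereal \<Rightarrow> real \<Rightarrow> 'p set \<Rightarrow> real^'p^'p \<Rightarrow> ereal" where
  "weak_cif q \<xi> A S = (INF b \<in> {b \<in> cone_set \<xi> A. b \<noteq> 0}.
     ereal (real (card A) powr real_of_ereal (1 / q) * (b \<bullet> (S *v b)) /
       (lq_norm 1 (subvec A b) * lq_norm q b)))"

end

theory Submission
  imports Defs
begin

text \<open>The argument runs along a single sample path, where the \<open>N i\<close> are step functions with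
  integer values and the \<open>Y i\<close> are indicators. These two facts turn the negative log-partial
  likelihood into a linear function plus a finite nonnegative combination of log-sum-exp functions,
  one for each jump time at which at least two individuals are at risk
  (\<open>neg_log_pl_eq_log_sum_exp\<close>). There are finitely many such times even if the path jumps
  infinitely often: at \<open>\<beta> = 0\<close> the logarithmic integrand is at least \<open>ln 2\<close> there, and
  it is integrable. At all other times it is linear in \<open>\<beta>\<close>, so that these times contribute
  neither to the Hessian nor to the Bregman divergence.

  The central estimate is a multiplicative comparison of the symmetric Bregman divergence with the
  Hessian quadratic form, \<open>h' (\<nabla>l (x + h) - \<nabla>l x) \<ge> exp (- K |h|\<^sub>1) h' H(x) h\<close>
  (\<open>log_sum_exp_form_bregman\<close>). For one log-sum-exp function both sides are, up to
  normalisation, sums over pairs \<open>(i, j)\<close> with the same weights, one of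
  \<open>(a i - a j) (exp (a i) - exp (a j))\<close> and the other of \<open>(a i - a j)\<^sup>2\<close>, where
  \<open>a i = z i \<bullet> h\<close>; convexity of \<open>exp\<close> compares them term by term. The comparison is strict
  where the quadratic form is positive.

  Let \<open>\<theta> = \<beta>hat - \<beta>o\<close>, let \<open>D\<close> be the divergence between the two vectors,
  and let \<open>P\<close> and \<open>Q\<close> be the \<open>l\<^sub>1\<close> norms of \<open>\<theta>\<close> on and off the support of
  \<open>\<beta>o\<close>. Minimality of the lasso estimator gives the basic inequality
  \<open>D \<le> 2 lam (\<xi> P - Q) / (\<xi> + 1)\<close> (\<open>lasso_basic_inequality\<close>). Suppose that
  \<open>lam > 0\<close>. As \<open>D \<ge> 0\<close>, the basic inequality places \<open>\<theta>\<close> in the cone, where the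
  compatibility factor bounds the quadratic form from below. The exponential loss factor has then
  to be controlled, and for this \<open>K |\<theta>|\<^sub>1 \<le> \<eta>\<close> is needed (\<open>bregman_radius\<close>).
  Otherwise, the point \<open>t \<theta>\<close> with \<open>K |t \<theta>|\<^sub>1 = \<eta>\<close> would lie strictly
  between \<open>0\<close> and \<open>\<theta>\<close>; the comparison at this point, the monotonicity of the gradient
  and the basic inequality would yield \<open>\<eta> exp (- \<eta>) < \<tau>\<close>, against the choice of
  \<open>\<eta>\<close>. Strictness is what makes this argument cover the boundary case
  \<open>\<tau> = 1/e\<close>, in which \<open>u exp (- u) \<le> \<tau>\<close> holds for every \<open>u\<close>.

  With the radius known, \<open>\<theta>' H \<theta> \<le> exp \<eta> D\<close>, and the three bounds follow from the
  definitions of the two factors. If the support is empty, then the cone is trivial and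
  \<open>\<theta> = 0\<close>; if \<open>lam = 0\<close>, then the basic inequality says \<open>D \<le> 0\<close>.\<close>

section \<open>Log-sum-exp functions and their Bregman divergence\<close>

definition log_sum_exp :: "'i set \<Rightarrow> ('i \<Rightarrow> 'a::euclidean_space) \<Rightarrow> 'a \<Rightarrow> real" where
  "log_sum_exp R z x = ln (\<Sum>i\<in>R. exp (z i \<bullet> x))"

definition softmax_mean :: "'i set \<Rightarrow> ('i \<Rightarrow> 'a::euclidean_space) \<Rightarrow> 'a \<Rightarrow> 'a" where
  "softmax_mean R z x = (\<Sum>i\<in>R. exp (z i \<bullet> x) *\<^sub>R z i) /\<^sub>R (\<Sum>i\<in>R. exp (z i \<bullet> x))"

text \<open>The covariance operator of the points \<open>z i\<close> under the softmax weights, applied to \<open>h\<close>. It is a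
  vector-valued function of \<open>h\<close> and not a matrix in order to serve directly as a Frechet derivative.\<close>

definition softmax_covariance :: "'i set \<Rightarrow> ('i \<Rightarrow> 'a::euclidean_space) \<Rightarrow> 'a \<Rightarrow> 'a \<Rightarrow> 'a" where
  "softmax_covariance R z x h =
     (\<Sum>i\<in>R. (exp (z i \<bullet> x) * (z i \<bullet> h)) *\<^sub>R z i) /\<^sub>R (\<Sum>i\<in>R. exp (z i \<bullet> x))
     - (softmax_mean R z x \<bullet> h) *\<^sub>R softmax_mean R z x"

lemma sum_exp_pos:
  assumes "finite R" "R \<noteq> {}"
  shows "(\<Sum>i\<in>R. exp (f i)) > (0::real)"
  using assms by (intro sum_pos) auto

lemma log_sum_exp_gradient:
  assumes "finite R" "R \<noteq> {}"
  shows "GDERIV (log_sum_exp R z) x :> softmax_mean R z x"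
proof -
  let ?S = "\<Sum>i\<in>R. exp (z i \<bullet> x)"
  have "((\<lambda>y. ln (\<Sum>i\<in>R. exp (z i \<bullet> y))) has_derivative
      (\<lambda>h. (\<Sum>i\<in>R. exp (z i \<bullet> x) * (z i \<bullet> h)) / ?S)) (at x)"
    using sum_exp_pos[OF assms, of "\<lambda>i. z i \<bullet> x"]
    by (auto intro!: derivative_eq_intros simp: divide_inverse mult.commute)
  moreover have "(\<Sum>i\<in>R. exp (z i \<bullet> x) * (z i \<bullet> h)) / ?S = h \<bullet> softmax_mean R z x" for h
    by (simp add: softmax_mean_def inner_sum_right inner_commute divide_inverse mult.commute)
  ultimately show ?thesis
    by (simp add: gderiv_def log_sum_exp_def[abs_def])
qed

lemma softmax_mean_derivative:
  assumes "finite R" "R \<noteq> {}"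
  shows "(softmax_mean R z has_derivative softmax_covariance R z x) (at x)"
proof -
  let ?S = "\<Sum>i\<in>R. exp (z i \<bullet> x)"
  have pos: "?S > 0" by (rule sum_exp_pos[OF assms])
  have "((\<lambda>y. (\<Sum>i\<in>R. exp (z i \<bullet> y) *\<^sub>R z i) /\<^sub>R (\<Sum>i\<in>R. exp (z i \<bullet> y)))
      has_derivative (\<lambda>h. inverse ?S *\<^sub>R (\<Sum>i\<in>R. (exp (z i \<bullet> x) * (z i \<bullet> h)) *\<^sub>R z i)
        + (- (inverse ?S * (\<Sum>i\<in>R. exp (z i \<bullet> x) * (z i \<bullet> h)) * inverse ?S)) *\<^sub>R
            (\<Sum>i\<in>R. exp (z i \<bullet> x) *\<^sub>R z i))) (at x)"
    using pos
    by (auto intro!: derivative_eq_intros simp: mult.commute)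
  moreover have "inverse ?S *\<^sub>R (\<Sum>i\<in>R. (exp (z i \<bullet> x) * (z i \<bullet> h)) *\<^sub>R z i)
        + (- (inverse ?S * (\<Sum>i\<in>R. exp (z i \<bullet> x) * (z i \<bullet> h)) * inverse ?S)) *\<^sub>R
            (\<Sum>i\<in>R. exp (z i \<bullet> x) *\<^sub>R z i) = softmax_covariance R z x h" for h
    by (simp add: softmax_covariance_def softmax_mean_def inner_sum_left mult_ac)
  ultimately show ?thesis by (simp add: softmax_mean_def[abs_def])
qed

text \<open>Weighted covariances are sums over pairs. In this form a variance and a covariance with a monotone
  function can be compared term by term.\<close>

lemma pairwise_covariance:
  fixes p a c :: "'i \<Rightarrow> real"
  shows "(\<Sum>i\<in>R. \<Sum>j\<in>R. p i * p j * ((a i - a j) * (c i - c j)))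
    = 2 * ((\<Sum>i\<in>R. p i) * (\<Sum>i\<in>R. p i * a i * c i) - (\<Sum>i\<in>R. p i * a i) * (\<Sum>i\<in>R. p i * c i))"
proof -
  have "(\<Sum>i\<in>R. \<Sum>j\<in>R. p i * p j * ((a i - a j) * (c i - c j)))
    = (\<Sum>i\<in>R. \<Sum>j\<in>R. (p i * a i * c i) * p j + p i * (p j * a j * c j)
        - (p i * a i) * (p j * c j) - (p i * c i) * (p j * a j))"
    by (intro sum.cong refl) (simp add: algebra_simps)
  also have "\<dots> = 2 * ((\<Sum>i\<in>R. p i) * (\<Sum>i\<in>R. p i * a i * c i)
      - (\<Sum>i\<in>R. p i * a i) * (\<Sum>i\<in>R. p i * c i))"
    by (simp add: sum.distrib sum_subtractf flip: sum_product) 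
  finally show ?thesis .
qed

text \<open>The slope of \<open>exp\<close> between two points of \<open>{m..}\<close> exceeds its derivative at \<open>m\<close>.\<close>

lemma exp_increment_product:
  fixes x y m :: real
  assumes "m \<le> x" "m \<le> y"
  shows "exp m * (x - y)\<^sup>2 \<le> (x - y) * (exp x - exp y)"
    and "x \<noteq> y \<Longrightarrow> exp m * (x - y)\<^sup>2 < (x - y) * (exp x - exp y)"
proof -
  have strict: "exp m * (u - v)\<^sup>2 < (u - v) * (exp u - exp v)" if "v < u" "m \<le> v" for u v :: real
  proof -
    have "1 + (u - v) < exp (u - v)"
      using exp_lower_Taylor_quadratic[of "u - v"] zero_less_power[of "u - v" 2] that by linarith
    then have "(u - v) * exp v < exp v * (exp (u - v) - 1)" by simp
    also have "\<dots> = exp u - exp v" by (simp add: exp_diff field_simps)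
    finally have "(u - v) * exp v < exp u - exp v" .
    moreover have "(u - v) * exp m \<le> (u - v) * exp v" using that by simp
    ultimately have "(u - v) * exp m < exp u - exp v" by linarith
    then have "(u - v) * ((u - v) * exp m) < (u - v) * (exp u - exp v)"
      using that by (intro mult_strict_left_mono) simp_all
    moreover have "exp m * (u - v)\<^sup>2 = (u - v) * ((u - v) * exp m)"
      by (simp add: power2_eq_square)
    ultimately show ?thesis by (simp only:)
  qed
  show less: "exp m * (x - y)\<^sup>2 < (x - y) * (exp x - exp y)" if "x \<noteq> y"
  proof (cases "y < x")
    case True
    then show ?thesis using strict assms by blast
  next
    case False
    then have "exp m * (y - x)\<^sup>2 < (y - x) * (exp y - exp x)" using strict that assms by simp
    then show ?thesis by (simp add: power2_commute algebra_simps)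
  qed
  show "exp m * (x - y)\<^sup>2 \<le> (x - y) * (exp x - exp y)"
    using less by (cases "x = y") auto
qed

text \<open>The quadratic form of the covariance is the variance of \<open>z i \<bullet> h\<close> under the softmax weights.\<close>

lemma softmax_covariance_quadratic:
  assumes "finite R" "R \<noteq> {}"
  shows "2 * (\<Sum>i\<in>R. exp (z i \<bullet> x))\<^sup>2 * (h \<bullet> softmax_covariance R z x h)
    = (\<Sum>i\<in>R. \<Sum>j\<in>R. exp (z i \<bullet> x) * exp (z j \<bullet> x) * (z i \<bullet> h - z j \<bullet> h)\<^sup>2)"
proof -
  let ?p = "\<lambda>i. exp (z i \<bullet> x)" and ?a = "\<lambda>i. z i \<bullet> h"
  let ?W = "sum ?p R"
  have pos: "?W > 0" by (rule sum_exp_pos[OF assms])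
  have m: "softmax_mean R z x \<bullet> h = (\<Sum>i\<in>R. ?p i * ?a i) / ?W"
    by (simp add: softmax_mean_def inner_sum_left divide_inverse mult_ac)
  have "h \<bullet> softmax_covariance R z x h
     = (\<Sum>i\<in>R. ?p i * ?a i * ?a i) / ?W - (softmax_mean R z x \<bullet> h)\<^sup>2"
    by (simp add: softmax_covariance_def inner_diff_right inner_sum_right inner_commute[of h]
        power2_eq_square divide_inverse mult_ac)
  then have "2 * ?W\<^sup>2 * (h \<bullet> softmax_covariance R z x h)
     = 2 * (?W * (\<Sum>i\<in>R. ?p i * ?a i * ?a i) - (\<Sum>i\<in>R. ?p i * ?a i) * (\<Sum>i\<in>R. ?p i * ?a i))"
    using pos unfolding m by (simp add: field_simps power2_eq_square)
  also have "\<dots> = (\<Sum>i\<in>R. \<Sum>j\<in>R. ?p i * ?p j * ((?a i - ?a j) * (?a i - ?a j)))"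
    by (rule pairwise_covariance[symmetric])
  finally show ?thesis by (simp add: power2_eq_square)
qed

text \<open>The weights at \<open>x + h\<close> are those at \<open>x\<close> tilted by \<open>exp (z i \<bullet> h)\<close>; hence the increment of
  the mean is, up to normalisation, the covariance of \<open>z i \<bullet> h\<close> with its own exponential under the
  weights at \<open>x\<close>.\<close>

lemma softmax_mean_increment:
  assumes "finite R" "R \<noteq> {}"
  shows "2 * (\<Sum>i\<in>R. exp (z i \<bullet> x)) * (\<Sum>i\<in>R. exp (z i \<bullet> (x + h)))
      * (h \<bullet> (softmax_mean R z (x + h) - softmax_mean R z x))
    = (\<Sum>i\<in>R. \<Sum>j\<in>R. exp (z i \<bullet> x) * exp (z j \<bullet> x) *
        ((z i \<bullet> h - z j \<bullet> h) * (exp (z i \<bullet> h) - exp (z j \<bullet> h))))"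
proof -
  let ?p = "\<lambda>i. exp (z i \<bullet> x)" and ?a = "\<lambda>i. z i \<bullet> h"
  let ?W = "sum ?p R" and ?S = "\<Sum>i\<in>R. exp (z i \<bullet> (x + h))"
  have pos: "?W > 0" "?S > 0" by (rule sum_exp_pos[OF assms])+
  have e: "exp (z i \<bullet> (x + h)) = ?p i * exp (?a i)" for i
    by (simp add: inner_add_right exp_add)
  have m: "h \<bullet> softmax_mean R z x = (\<Sum>i\<in>R. ?p i * ?a i) / ?W"
     "h \<bullet> softmax_mean R z (x + h) = (\<Sum>i\<in>R. ?p i * ?a i * exp (?a i)) / ?S"
    by (simp_all add: softmax_mean_def inner_sum_right divide_inverse mult_ac inner_commute[of h] e)
  have "2 * ?W * ?S * (h \<bullet> (softmax_mean R z (x + h) - softmax_mean R z x))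
     = 2 * (?W * (\<Sum>i\<in>R. ?p i * ?a i * exp (?a i)) - (\<Sum>i\<in>R. ?p i * ?a i) * ?S)"
    using pos unfolding inner_diff_right m by (simp add: field_simps)
  also have "\<dots> = (\<Sum>i\<in>R. \<Sum>j\<in>R. ?p i * ?p j * ((?a i - ?a j) * (exp (?a i) - exp (?a j))))"
    unfolding e by (rule pairwise_covariance[symmetric])
  finally show ?thesis .
qed

text \<open>After clearing denominators, \<open>D\<close> and \<open>Q\<close> are the two sums over pairs above. If \<open>m\<close> is the least
  of the values \<open>z i \<bullet> h\<close>, then passing from one sum to the other costs a factor \<open>exp m\<close>, and the
  normalising constants differ by a factor of at most \<open>exp (m + \<eta>)\<close>; the quotient of the
  two is \<open>exp (- \<eta>)\<close>.\<close>

lemma log_sum_exp_bregman_lower: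
  fixes z :: "'i \<Rightarrow> 'a::euclidean_space" and x h :: 'a
  assumes R: "finite R" "R \<noteq> {}" and osc: "\<And>i j. i \<in> R \<Longrightarrow> j \<in> R \<Longrightarrow> \<bar>z i \<bullet> h - z j \<bullet> h\<bar> \<le> \<eta>"
  defines "D \<equiv> h \<bullet> (softmax_mean R z (x + h) - softmax_mean R z x)"
    and "Q \<equiv> h \<bullet> softmax_covariance R z x h"
  shows "0 \<le> Q" and "exp (- \<eta>) * Q \<le> D" and "0 < Q \<Longrightarrow> exp (- \<eta>) * Q < D"
proof -
  let ?p = "\<lambda>i. exp (z i \<bullet> x)" and ?a = "\<lambda>i. z i \<bullet> h"
  let ?W = "sum ?p R" and ?S = "\<Sum>i\<in>R. exp (z i \<bullet> (x + h))"
  let ?q = "\<Sum>i\<in>R. \<Sum>j\<in>R. ?p i * ?p j * (?a i - ?a j)\<^sup>2"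
  let ?d = "\<Sum>i\<in>R. \<Sum>j\<in>R. ?p i * ?p j * ((?a i - ?a j) * (exp (?a i) - exp (?a j)))"
  have pos: "?W > 0" "?S > 0" by (rule sum_exp_pos[OF R])+
  have Q: "2 * ?W\<^sup>2 * Q = ?q" unfolding Q_def by (rule softmax_covariance_quadratic[OF R])
  have D: "2 * ?W * ?S * D = ?d" unfolding D_def by (rule softmax_mean_increment[OF R])
  have "0 \<le> ?q" by (intro sum_nonneg) simp
  then show Q0: "0 \<le> Q" unfolding Q[symmetric] using pos by (simp add: zero_le_mult_iff)
  define m where "m = Min (?a ` R)"
  have m: "m \<le> ?a i" if "i \<in> R" for i unfolding m_def using that R by simp
  have "m \<in> ?a ` R" unfolding m_def using R by (intro Min_in) auto
  then obtain k where k: "k \<in> R" "m = ?a k" by auto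
  have M: "?a i \<le> m + \<eta>" if "i \<in> R" for i using osc[OF that k(1)] k by simp
  have "?S \<le> (\<Sum>i\<in>R. ?p i * exp (m + \<eta>))"
    by (intro sum_mono) (auto simp: inner_add_right exp_add[of "_ \<bullet> x"] M)
  then have S: "?S \<le> ?W * exp (m + \<eta>)" by (simp add: sum_distrib_right)
  have q_mult: "exp m * ?q = (\<Sum>i\<in>R. \<Sum>j\<in>R. ?p i * ?p j * (exp m * (?a i - ?a j)\<^sup>2))"
    by (simp add: sum_distrib_left mult_ac)
  have qd: "exp m * ?q \<le> ?d"
    unfolding q_mult by (intro sum_mono mult_left_mono exp_increment_product m) auto
  have *: "2 * ?W * ?S * (exp (- \<eta>) * Q) \<le> exp m * ?q"
  proof -
    have "2 * ?W * ?S * (exp (- \<eta>) * Q) \<le> 2 * ?W * (?W * exp (m + \<eta>)) * (exp (- \<eta>) * Q)"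
      using pos Q0 S by (intro mult_right_mono mult_left_mono) auto
    also have "\<dots> = exp m * (2 * ?W\<^sup>2 * Q)"
      by (simp add: power2_eq_square exp_add exp_minus)
    finally show ?thesis unfolding Q .
  qed
  then have "2 * ?W * ?S * (exp (- \<eta>) * Q) \<le> 2 * ?W * ?S * D" using qd D by linarith
  then show "exp (- \<eta>) * Q \<le> D" using pos by simp
  show "exp (- \<eta>) * Q < D" if "0 < Q"
  proof -
    have "?q \<noteq> 0" unfolding Q[symmetric] using pos that by simp
    then obtain i j where ij: "i \<in> R" "j \<in> R" "?a i \<noteq> ?a j"
      by (metis (mono_tags, lifting) sum.neutral diff_self mult_zero_right zero_power2)
    have le: "?p i * ?p j * (exp m * (?a i - ?a j)\<^sup>2)
        \<le> ?p i * ?p j * ((?a i - ?a j) * (exp (?a i) - exp (?a j)))" if "i \<in> R" "j \<in> R" for i j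
      using that by (intro mult_left_mono exp_increment_product m) auto
    have "?p i * ?p j * (exp m * (?a i - ?a j)\<^sup>2)
        < ?p i * ?p j * ((?a i - ?a j) * (exp (?a i) - exp (?a j)))"
      using ij by (intro mult_strict_left_mono exp_increment_product m) auto
    then have "(\<Sum>j\<in>R. ?p i * ?p j * (exp m * (?a i - ?a j)\<^sup>2))
        < (\<Sum>j\<in>R. ?p i * ?p j * ((?a i - ?a j) * (exp (?a i) - exp (?a j))))"
      using ij by (intro sum_strict_mono_ex1 R ballI le) auto
    then have "exp m * ?q < ?d" unfolding q_mult
      using ij(1) by (intro sum_strict_mono_ex1 R ballI sum_mono le) auto
    then have "2 * ?W * ?S * (exp (- \<eta>) * Q) < 2 * ?W * ?S * D" using * D by linarith
    then show ?thesis using pos by simp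
  qed
qed

section \<open>Stieltjes measures of integer-valued step functions\<close>

text \<open>Monotone right-continuous functions with natural values are closed under sums, in contrast to
  \<^const>\<open>counting_path\<close>, which limits the height of the jumps.\<close>

definition integer_step :: "(real \<Rightarrow> real) \<Rightarrow> bool" where
  "integer_step g \<longleftrightarrow> mono g \<and> (\<forall>t. continuous (at_right t) g) \<and> range g \<subseteq> \<nat>"

lemma integer_step_counting_path:
  assumes "counting_path f"
  shows "integer_step (\<lambda>t. f (max 0 t))"
proof -
  from assms have mono: "mono_on {0..} f" and cont: "\<And>t. t \<ge> 0 \<Longrightarrow> continuous (at_right t) f"
    and nat: "\<And>t. t \<ge> 0 \<Longrightarrow> f t \<in> \<nat>"
    by (auto simp: counting_path_def cadlag_increasing_def)
  have "continuous (at_right t) (\<lambda>t. f (max 0 t))" for t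
  proof (cases "t \<ge> 0")
    case True
    have "\<forall>\<^sub>F s in at_right t. f (max 0 s) = f s"
      using True by (auto simp: eventually_at_filter)
    moreover have "(f \<longlongrightarrow> f t) (at_right t)"
      using cont[OF True] by (simp add: continuous_within)
    ultimately show ?thesis
      using True by (simp add: continuous_within tendsto_cong)
  next
    case False
    have "\<forall>\<^sub>F s in at_right t. s < 0"
      using False by (intro order_tendstoD(2)[OF tendsto_ident_at]) auto
    then have "\<forall>\<^sub>F s in at_right t. f (max 0 s) = f 0"
      by eventually_elim simp
    then show ?thesis
      using False by (simp add: continuous_within tendsto_eventually)
  qed
  moreover have "mono (\<lambda>t. f (max 0 t))"
    by (intro monoI mono_onD[OF mono]) auto
  ultimately show ?thesis using nat by (auto simp: integer_step_def)
qed

lemma integer_step_sum: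
  assumes "\<And>i. i \<in> I \<Longrightarrow> integer_step (g i)"
  shows "integer_step (\<lambda>t. \<Sum>i\<in>I. g i t)"
proof -
  have "mono (\<lambda>t. \<Sum>i\<in>I. g i t)"
    using assms by (intro monoI sum_mono) (auto simp: integer_step_def mono_def)
  moreover have "continuous (at_right t) (\<lambda>t. \<Sum>i\<in>I. g i t)" for t
    using assms by (intro continuous_sum) (auto simp: integer_step_def)
  moreover have "(\<Sum>i\<in>I. g i t) \<in> \<nat>" for t
  proof -
    have "\<forall>i\<in>I. g i t \<in> \<nat>" using assms by (auto simp: integer_step_def image_subset_iff)
    then show ?thesis by (induction I rule: infinite_finite_induct) auto
  qed
  ultimately show ?thesis by (auto simp: integer_step_def)
qed

lemma Nats_dist_less_1: "x \<in> \<nat> \<Longrightarrow> y \<in> \<nat> \<Longrightarrow> \<bar>x - y\<bar> < 1 \<Longrightarrow> x = (y::real)"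
  by (auto elim!: Nats_cases)

lemma integer_step_const_right:
  assumes "integer_step g"
  obtains b where "t < b" "\<And>s. s \<in> {t<..<b} \<Longrightarrow> g s = g t"
proof -
  have "(g \<longlongrightarrow> g t) (at_right t)"
    using assms by (simp add: integer_step_def continuous_within)
  then have "\<forall>\<^sub>F s in at_right t. dist (g s) (g t) < 1"
    by (rule tendstoD) simp
  then have "\<forall>\<^sub>F s in at_right t. g s = g t"
    by eventually_elim
      (use assms in \<open>auto intro!: Nats_dist_less_1 simp: dist_real_def integer_step_def\<close>)
  then show thesis
    using that by (auto simp: eventually_at_right_field)
qed

text \<open>On the left of \<open>t\<close> no continuity is available; instead the integer values below \<open>t\<close> are bounded
  by \<open>g t\<close> and therefore have a greatest element, which is attained and kept up to \<open>t\<close>.\<close>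

lemma integer_step_const_left:
  assumes "integer_step g"
  obtains a c where "a < t" "\<And>s. s \<in> {a<..<t} \<Longrightarrow> g s = c"
proof -
  have mono: "mono g" and nat: "\<And>s. g s \<in> \<nat>" using assms by (auto simp: integer_step_def)
  have of: "of_nat (nat \<lfloor>g s\<rfloor>) = g s" for s using nat[of s] by (auto elim!: Nats_cases)
  \<comment> \<open>a maximiser of the integer value among the times before \<open>t\<close>; \<open>t - 1\<close> is merely one such time\<close>
  have "\<exists>s. s < t \<and> (\<forall>s'. s' < t \<longrightarrow> nat \<lfloor>g s'\<rfloor> \<le> nat \<lfloor>g s\<rfloor>)"
    by (rule ex_has_greatest_nat[where k = "t - 1" and b = "Suc (nat \<lfloor>g t\<rfloor>)"])
      (auto intro!: le_imp_less_Suc nat_mono floor_mono monoD[OF mono])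
  then obtain a where a: "a < t" "\<And>s. s < t \<Longrightarrow> nat \<lfloor>g s\<rfloor> \<le> nat \<lfloor>g a\<rfloor>" by auto
  have "g s = g a" if "s \<in> {a<..<t}" for s
  proof (rule antisym)
    show "g s \<le> g a" using a(2)[of s] that of by (metis greaterThanLessThan_iff of_nat_le_iff)
    show "g a \<le> g s" using that by (auto intro: monoD[OF mono])
  qed
  with a(1) that show thesis by blast
qed

lemma interval_measure_const_null:
  assumes g: "integer_step g" and c: "\<And>s. s \<in> {a<..<b} \<Longrightarrow> g s = c"
  shows "{a<..<b} \<in> null_sets (interval_measure g)"
proof -
  let ?P = "{(p, q). p \<in> \<rat> \<and> q \<in> \<rat> \<and> a < p \<and> p \<le> q \<and> q < b}"
  \<comment> \<open>The half-open pieces with rational end points stay inside the interval on which \<open>g\<close> is constant.\<close>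
  have "{a<..<b} \<subseteq> (\<Union>(p, q)\<in>?P. {p<..q})"
  proof
    fix s assume s: "s \<in> {a<..<b}"
    then obtain p q where "p \<in> \<rat>" "a < p" "p < s" "q \<in> \<rat>" "s < q" "q < b"
      by (metis Rats_dense_in_real greaterThanLessThan_iff)
    then show "s \<in> (\<Union>(p, q)\<in>?P. {p<..q})" by (intro UN_I[of "(p, q)"]) auto
  qed
  moreover have "(\<Union>(p, q)\<in>?P. {p<..q}) \<in> null_sets (interval_measure g)"
  proof (rule null_sets_UN')
    have "?P \<subseteq> \<rat> \<times> \<rat>" by auto
    then show "countable ?P" by (rule countable_subset) (simp add: countable_rat)
    show "(case x of (p, q) \<Rightarrow> {p<..q}) \<in> null_sets (interval_measure g)" if "x \<in> ?P" for x
      using that g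
      by (auto simp: null_sets_def emeasure_interval_measure_Ioc integer_step_def c monoD)
  qed
  ultimately show ?thesis by (rule null_sets_subset[rotated 2]) simp
qed

text \<open>The mass of an atom is an increment of \<open>g\<close>, hence an integer.\<close>

lemma emeasure_integer_step_atom:
  assumes g: "integer_step g" and nz: "emeasure (interval_measure g) {t} \<noteq> 0"
  shows "1 \<le> emeasure (interval_measure g) {t}"
proof -
  obtain a c where a: "a < t" "\<And>s. s \<in> {a<..<t} \<Longrightarrow> g s = c"
    using integer_step_const_left[OF g] by metis
  define p where "p = (a + t) / 2"
  have p: "a < p" "p < t" using a(1) by (auto simp: p_def)
  have "{p<..<t} \<in> null_sets (interval_measure g)"
    using p a(2) by (intro interval_measure_const_null[OF g, of _ _ c]) auto
  then have "emeasure (interval_measure g) ({t} \<union> {p<..<t}) = emeasure (interval_measure g) {t}"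
    by (intro emeasure_Un_null_set) auto
  also have "{t} \<union> {p<..<t} = {p<..t}" using p by auto
  also have "emeasure (interval_measure g) {p<..t} = ennreal (g t - g p)"
    using g p by (intro emeasure_interval_measure_Ioc) (auto simp: integer_step_def monoD)
  finally have eq: "emeasure (interval_measure g) {t} = ennreal (g t - g p)" by simp
  then have "0 < g t - g p" using nz by (auto simp: ennreal_eq_0_iff)
  moreover have "g t \<in> \<nat>" "g p \<in> \<nat>" using g by (auto simp: integer_step_def)
  ultimately have "1 \<le> g t - g p" by (auto elim!: Nats_cases)
  then show ?thesis unfolding eq by (metis ennreal_1 ennreal_leI)
qed

text \<open>Every point has a neighbourhood that is null apart from the point itself, because \<open>g\<close> is constant
  on either side. Countably many of these neighbourhoods cover the line.\<close>

lemma integer_step_no_diffuse_part: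
  assumes g: "integer_step g"
  shows "AE t in interval_measure g. emeasure (interval_measure g) {t} \<noteq> 0"
proof -
  let ?\<mu> = "interval_measure g"
  have "\<exists>U. open U \<and> t \<in> U \<and> U - {t} \<in> null_sets ?\<mu>" for t
  proof -
    obtain a c where a: "a < t" "\<And>s. s \<in> {a<..<t} \<Longrightarrow> g s = c"
      using integer_step_const_left[OF g] by metis
    obtain b where b: "t < b" "\<And>s. s \<in> {t<..<b} \<Longrightarrow> g s = g t"
      using integer_step_const_right[OF g] by metis
    have "{a<..<t} \<union> {t<..<b} \<in> null_sets ?\<mu>"
      using interval_measure_const_null[OF g a(2)] interval_measure_const_null[OF g b(2)] by auto
    moreover have "{a<..<b} - {t} = {a<..<t} \<union> {t<..<b}" using a(1) b(1) by auto
    ultimately show ?thesis using a(1) b(1) by (intro exI[of _ "{a<..<b}"]) auto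
  qed
  then obtain U where U: "\<And>t. open (U t)" "\<And>t. t \<in> U t" "\<And>t. U t - {t} \<in> null_sets ?\<mu>"
    by metis
  obtain F where F: "F \<subseteq> range U" "countable F" "\<Union>F = \<Union>(range U)"
    by (rule Lindelof[of "range U"]) (auto simp: U(1))
  then obtain C where C: "countable C" "F = U ` C"
    using countable_subset_image[of F U UNIV] by auto
  have cover: "\<exists>u\<in>C. t \<in> U u" for t
    using F(3) U(2)[of t] unfolding C(2) by blast
  let ?D = "{t \<in> C. emeasure ?\<mu> {t} = 0}"
  let ?X = "(\<Union>t\<in>C. U t - {t}) \<union> (\<Union>t\<in>?D. {t})"
  have "countable ?D" using C(1) by (rule countable_subset[rotated]) auto
  then have "?X \<in> null_sets ?\<mu>"
    using C(1) U(3) by (intro null_sets.Un null_sets_UN') (auto simp: null_sets_def)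
  moreover have "{t \<in> space ?\<mu>. \<not> emeasure ?\<mu> {t} \<noteq> 0} \<subseteq> ?X"
    using cover by blast
  ultimately show ?thesis by (rule AE_I'[of ?X])
qed

lemma integer_step_finite_atoms:
  assumes g: "integer_step g" and B: "B \<in> sets borel" "emeasure (interval_measure g) B < \<infinity>"
  shows "finite {t \<in> B. emeasure (interval_measure g) {t} \<noteq> 0}" (is "finite ?J")
proof (rule ccontr)
  let ?\<mu> = "interval_measure g"
  assume "infinite ?J"
  obtain m where m: "emeasure ?\<mu> B = ennreal m" "0 \<le> m"
    using B(2) by (cases "emeasure ?\<mu> B") auto
  obtain k :: nat where k: "m < k" using reals_Archimedean2 by blast
  obtain T where T: "finite T" "card T = k" "T \<subseteq> ?J"
    using infinite_arbitrarily_large[OF \<open>infinite ?J\<close>] by metis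
  have "of_nat k = (\<Sum>t\<in>T. (1::ennreal))" using T(2) by simp
  also have "\<dots> \<le> (\<Sum>t\<in>T. emeasure ?\<mu> {t})"
    using T(3) by (intro sum_mono emeasure_integer_step_atom[OF g]) auto
  also have "\<dots> = emeasure ?\<mu> T"
    using T(1) by (intro emeasure_eq_sum_singleton[symmetric]) auto
  also have "\<dots> \<le> emeasure ?\<mu> B" using B(1) T(3) by (intro emeasure_mono) auto
  finally have "ennreal (real k) \<le> ennreal m" by (simp add: m ennreal_of_nat_eq_real_of_nat)
  then show False using k m(2) by (simp add: ennreal_le_iff)
qed

lemma integer_step_integral_eq_sum:
  fixes h :: "real \<Rightarrow> real"
  assumes g: "integer_step g" and B: "B \<in> sets borel" "emeasure (interval_measure g) B < \<infinity>"
    and h: "set_integrable (interval_measure g) B h"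
  shows "(LINT t:B|interval_measure g. h t)
    = (\<Sum>t\<in>{t \<in> B. emeasure (interval_measure g) {t} \<noteq> 0}. measure (interval_measure g) {t} * h t)"
proof -
  let ?\<mu> = "interval_measure g" and ?J = "{t \<in> B. emeasure (interval_measure g) {t} \<noteq> 0}"
  have fin: "finite ?J" by (rule integer_step_finite_atoms[OF g B])
  have atom: "emeasure ?\<mu> {t} < \<infinity>" if "t \<in> B" for t
    using emeasure_mono[of "{t}" B ?\<mu>] B that by (auto simp: le_less_trans)
  have "(LINT t:B|?\<mu>. h t) = (LINT t|?\<mu>. (\<Sum>s\<in>?J. indicator {s} t *\<^sub>R h s))"
    unfolding set_lebesgue_integral_def
  proof (rule integral_cong_AE)
    show "(\<lambda>t. indicator B t *\<^sub>R h t) \<in> borel_measurable ?\<mu>"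
      using h by (simp add: set_integrable_def borel_measurable_integrable)
    show "AE t in ?\<mu>. indicator B t *\<^sub>R h t = (\<Sum>s\<in>?J. indicator {s} t *\<^sub>R h s)"
      using integer_step_no_diffuse_part[OF g]
    proof eventually_elim
      case (elim t)
      have "(\<Sum>s\<in>?J. indicator {s} t *\<^sub>R h s) = (\<Sum>s\<in>?J. if s = t then h t else 0)"
        by (intro sum.cong) (auto simp: indicator_def)
      then show ?case using fin elim by (auto simp: indicator_def)
    qed
  qed simp
  also have "\<dots> = (\<Sum>s\<in>?J. (LINT t|?\<mu>. indicator {s} t *\<^sub>R h s))"
    using atom by (intro Bochner_Integration.integral_sum integrable_indicator integrable_scaleR_left) auto
  also have "\<dots> = (\<Sum>t\<in>?J. measure ?\<mu> {t} * h t)"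
    using atom by (intro sum.cong) auto
  finally show ?thesis .
qed

section \<open>The log-partial likelihood along a sample path\<close>

lemma linear_functional_inner:
  fixes f :: "'a::euclidean_space \<Rightarrow> real"
  assumes "linear f"
  obtains a where "\<And>x. f x = a \<bullet> x"
  using adjoint_works[OF assms, of _ 1] that[of "adjoint f 1"] by (simp add: inner_commute)

text \<open>The time axis is split at the set \<open>B\<close> of times with at least two individuals at risk. Integrability
  of the logarithmic term at \<open>\<beta> = 0\<close>, where it is the logarithm of the number at risk,
  makes \<open>B\<close> a set of finite measure, on which the integral is a finite sum. Outside \<open>B\<close> the sum under
  the logarithm is empty or a single exponential, so that the integrand is linear in
  \<open>\<beta>\<close>; with nobody at risk this is the convention \<open>ln 0 = 0\<close>.\<close>

lemma neg_log_pl_eq_log_sum_exp: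
  fixes N Y :: "nat \<Rightarrow> real \<Rightarrow> 'w \<Rightarrow> real" and Z :: "nat \<Rightarrow> real \<Rightarrow> 'w \<Rightarrow> real^'p"
  assumes counting: "\<And>i. i \<in> {1..n} \<Longrightarrow> counting_path (\<lambda>t. N i t \<omega>)"
    and ind: "\<And>i t. i \<in> {1..n} \<Longrightarrow> 0 \<le> t \<Longrightarrow> Y i t \<omega> \<in> {0, 1}"
    and ex: "neg_log_pl_exists n N Y Z \<omega>"
  obtains a and T :: "real set" and c and R :: "real \<Rightarrow> nat set"
  where "finite T" "T \<subseteq> {0..}" "\<And>s. 0 \<le> c s" "\<And>s. R s \<subseteq> {1..n}" "\<And>s. s \<in> T \<Longrightarrow> R s \<noteq> {}"
    and "neg_log_pl n N Y Z \<omega> =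
      (\<lambda>\<beta>. a \<bullet> \<beta> + (\<Sum>s\<in>T. c s * log_sum_exp (R s) (\<lambda>i. Z i s \<omega>) \<beta>))"
proof -
  define \<mu> where "\<mu> = stieltjes (\<lambda>t. \<Sum>i=1..n. N i t \<omega>)"
  define g where "g = (\<lambda>t. \<Sum>i=1..n. N i (max 0 t) \<omega>)"
  define R where "R s = {i \<in> {1..n}. Y i s \<omega> = 1}" for s
  define h where "h s \<beta> = ln (\<Sum>i=1..n. Y i s \<omega> * exp (Z i s \<omega> \<bullet> \<beta>))" for s and \<beta> :: "real^'p"
  have \<mu>: "\<mu> = interval_measure g" by (simp add: \<mu>_def g_def stieltjes_def)
  have step: "integer_step g"
    unfolding g_def using integer_step_counting_path[OF counting] by (rule integer_step_sum)
  have [simp]: "sets \<mu> = sets borel" "space \<mu> = UNIV" by (simp_all add: \<mu>)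
  have fin_R: "finite (R s)" for s by (simp add: R_def)
  have intZ: "set_integrable (stieltjes (\<lambda>t. N i t \<omega>)) {0..} (\<lambda>s. Z i s \<omega> \<bullet> \<beta>)"
    if "i \<in> {1..n}" for i \<beta>
    using ex that by (auto simp: neg_log_pl_exists_def)
  have inth: "set_integrable \<mu> {0..} (\<lambda>s. h s \<beta>)" for \<beta>
    using ex by (auto simp: neg_log_pl_exists_def h_def \<mu>_def)
  have h_lse: "h s \<beta> = log_sum_exp (R s) (\<lambda>i. Z i s \<omega>) \<beta>" if "0 \<le> s" for s \<beta>
  proof -
    have "(\<Sum>i=1..n. Y i s \<omega> * exp (Z i s \<omega> \<bullet> \<beta>))
        = (\<Sum>i=1..n. if Y i s \<omega> = 1 then exp (Z i s \<omega> \<bullet> \<beta>) else 0)"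
      using ind that by (intro sum.cong) fastforce+
    also have "\<dots> = (\<Sum>i\<in>R s. exp (Z i s \<omega> \<bullet> \<beta>))"
      unfolding R_def by (subst sum.inter_filter) auto
    finally show ?thesis by (simp add: h_def log_sum_exp_def)
  qed
  have h0: "h s 0 = ln (card (R s))" if "0 \<le> s" for s
    using h_lse[OF that] by (simp add: log_sum_exp_def)

  define B where "B = {s. ln 2 \<le> indicator {0..} s *\<^sub>R h s 0}"
  have B_iff: "s \<in> B \<longleftrightarrow> 0 \<le> s \<and> 2 \<le> card (R s)" for s
  proof (cases "card (R s) = 0")
    case True
    then show ?thesis by (auto simp: B_def indicator_def h0)
  next
    case False
    then show ?thesis by (auto simp: B_def indicator_def h0)
  qed
  have int0: "integrable \<mu> (\<lambda>s. indicator {0..} s *\<^sub>R h s 0)"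
    using inth[of 0] by (simp add: set_integrable_def)
  have B_sets: "B \<in> sets borel"
  proof -
    have "{s \<in> space \<mu>. ln 2 \<le> indicator {0..} s *\<^sub>R h s 0} \<in> sets \<mu>"
      using int0 by (intro borel_measurable_le borel_measurable_const borel_measurable_integrable)
    then show ?thesis by (simp add: B_def)
  qed
  have B_finite: "emeasure \<mu> B < \<infinity>"
  proof -
    have "0 \<le> indicator {0..} s *\<^sub>R h s 0" for s
      by (cases "card (R s) = 0") (auto simp: indicator_def h0)
    then have "emeasure \<mu> {s \<in> space \<mu>. ln 2 \<le> indicator {0..} s *\<^sub>R h s 0}
        \<le> ennreal (1 / ln 2 * (\<integral>s. indicator {0..} s *\<^sub>R h s 0 \<partial>\<mu>))"
      by (intro integral_Markov_inequality[OF int0]) auto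
    then show ?thesis by (auto simp: B_def intro: le_less_trans)
  qed
  have B_sub: "B \<subseteq> {0..}" by (auto simp: B_iff)
  have intB: "set_integrable \<mu> B (\<lambda>s. h s \<beta>)" and intC: "set_integrable \<mu> ({0..} - B) (\<lambda>s. h s \<beta>)" for \<beta>
    using B_sets B_sub by (auto intro!: set_integrable_subset[OF inth])

  define T where "T = {s \<in> B. emeasure \<mu> {s} \<noteq> 0}"
  have finT: "finite T"
    unfolding T_def using integer_step_finite_atoms[OF step B_sets] B_finite by (simp add: \<mu>)
  define G where "G \<beta> = (LINT s:{0..} - B|\<mu>. h s \<beta>)" for \<beta>
  have split: "(LINT s:{0..}|\<mu>. h s \<beta>) = G \<beta> + (\<Sum>s\<in>T. measure \<mu> {s} * h s \<beta>)" for \<beta>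
  proof -
    have "{0..} = ({0..} - B) \<union> B" using B_sub by auto
    then have "(LINT s:{0..}|\<mu>. h s \<beta>) = (LINT s:({0..} - B) \<union> B|\<mu>. h s \<beta>)" by simp
    also have "\<dots> = G \<beta> + (LINT s:B|\<mu>. h s \<beta>)"
      unfolding G_def by (rule set_integral_Un[OF _ intC intB]) auto
    also have "(LINT s:B|\<mu>. h s \<beta>) = (\<Sum>s\<in>T. measure \<mu> {s} * h s \<beta>)"
      using integer_step_integral_eq_sum[OF step B_sets] B_finite intB by (simp add: \<mu> T_def)
    finally show ?thesis .
  qed

  have h_linear: "\<exists>v. \<forall>\<beta>. h s \<beta> = v \<bullet> \<beta>" if s: "s \<in> {0..} - B" for s
  proof -
    from s have "card (R s) = 0 \<or> card (R s) = 1" by (auto simp: B_iff)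
    then consider "R s = {}" | k where "R s = {k}"
      using fin_R by (auto simp: card_1_singleton_iff)
    then show ?thesis
    proof cases
      case 1
      then show ?thesis using s by (intro exI[of _ 0]) (auto simp: h_lse log_sum_exp_def)
    next
      case 2
      then show ?thesis using s by (auto simp: h_lse log_sum_exp_def)
    qed
  qed
  have "linear G"
  proof (rule linearI)
    fix \<beta> \<gamma> :: "real^'p" and r :: real
    have "G (\<beta> + \<gamma>) = (LINT s:{0..} - B|\<mu>. h s \<beta> + h s \<gamma>)"
      unfolding G_def using B_sets h_linear
      by (intro set_lebesgue_integral_cong) (simp, metis inner_add_right)
    then show "G (\<beta> + \<gamma>) = G \<beta> + G \<gamma>"
      using intC by (simp add: G_def set_integral_add)
    have "G (r *\<^sub>R \<beta>) = (LINT s:{0..} - B|\<mu>. r * h s \<beta>)"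
      unfolding G_def using B_sets h_linear
      by (intro set_lebesgue_integral_cong) (simp, metis inner_scaleR_right real_scaleR_def)
    then show "G (r *\<^sub>R \<beta>) = r *\<^sub>R G \<beta>"
      by (simp add: G_def set_integral_mult_right)
  qed
  moreover have "linear (\<lambda>\<beta>. \<Sum>i=1..n. LINT s:{0..}|stieltjes (\<lambda>t. N i t \<omega>). Z i s \<omega> \<bullet> \<beta>)"
    by (rule linearI)
      (simp_all add: inner_add_right set_integral_add intZ sum.distrib sum_distrib_left)
  ultimately have "linear (\<lambda>\<beta>. - (1 / real n) *\<^sub>R
      ((\<Sum>i=1..n. LINT s:{0..}|stieltjes (\<lambda>t. N i t \<omega>). Z i s \<omega> \<bullet> \<beta>) - G \<beta>))"
    by (intro linear_compose_scale_right linear_compose_sub)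
  then obtain a where a: "- (1 / real n) *
      ((\<Sum>i=1..n. LINT s:{0..}|stieltjes (\<lambda>t. N i t \<omega>). Z i s \<omega> \<bullet> \<beta>) - G \<beta>) = a \<bullet> \<beta>" for \<beta>
    by (rule linear_functional_inner) auto

  show thesis
  proof (rule that[of T "\<lambda>s. measure \<mu> {s} / n" R a])
    have "neg_log_pl n N Y Z \<omega> \<beta>
        = a \<bullet> \<beta> + (\<Sum>s\<in>T. measure \<mu> {s} / n * log_sum_exp (R s) (\<lambda>i. Z i s \<omega>) \<beta>)" for \<beta>
    proof -
      have "neg_log_pl n N Y Z \<omega> \<beta> = - (1 / real n) *
          ((\<Sum>i=1..n. LINT s:{0..}|stieltjes (\<lambda>t. N i t \<omega>). Z i s \<omega> \<bullet> \<beta>) -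
            (G \<beta> + (\<Sum>s\<in>T. measure \<mu> {s} * h s \<beta>)))"
        unfolding neg_log_pl_def split[symmetric] by (simp add: h_def \<mu>_def)
      also have "\<dots> = a \<bullet> \<beta> + (\<Sum>s\<in>T. measure \<mu> {s} * h s \<beta>) / n"
        unfolding a[symmetric] by (simp add: diff_divide_distrib add_divide_distrib)
      also have "(\<Sum>s\<in>T. measure \<mu> {s} * h s \<beta>) / n
          = (\<Sum>s\<in>T. measure \<mu> {s} / n * log_sum_exp (R s) (\<lambda>i. Z i s \<omega>) \<beta>)"
        unfolding sum_divide_distrib using B_sub by (intro sum.cong) (auto simp: T_def h_lse)
      finally show ?thesis .
    qed
    then show "neg_log_pl n N Y Z \<omega> = (\<lambda>\<beta>. a \<bullet> \<beta> +
        (\<Sum>s\<in>T. measure \<mu> {s} / n * log_sum_exp (R s) (\<lambda>i. Z i s \<omega>) \<beta>))" by blast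
    show "R s \<noteq> {}" if "s \<in> T" for s
      using that B_iff[of s] by (auto simp: T_def)
  qed (use finT B_sub in \<open>auto simp: T_def R_def\<close>)
qed

section \<open>Gradient and Hessian of the log-partial likelihood\<close>

lemma lq_norm_1: "lq_norm 1 v = (\<Sum>j\<in>UNIV. \<bar>v $ j\<bar>)"
  by (simp add: lq_norm_def sum_nonneg)

lemma gradient_eq:
  assumes "GDERIV f x :> g"
  shows "gradient f x = g"
  unfolding gradient_def
proof (rule the_equality)
  show "GDERIV f x :> g" by (rule assms)
next
  fix g' assume "GDERIV f x :> g'"
  then have "(\<lambda>h. h \<bullet> g') = (\<lambda>h. h \<bullet> g)"
    using assms unfolding gderiv_def by (rule has_derivative_unique)
  then show "g' = g" by (metis vector_eq_ldot)
qed

lemma hessian_mult: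
  assumes grad: "\<And>y. GDERIV f y :> G y" and "(G has_derivative G') (at x)"
  shows "hessian f x *v h = G' h"
proof -
  have "gradient f = G" using gradient_eq[OF grad] by blast
  then have "frechet_derivative (gradient f) (at x) = G'"
    using assms(2) by (simp add: frechet_derivative_at[symmetric])
  then show ?thesis
    using assms(2) by (simp add: hessian_def matrix_works has_derivative_linear)
qed

text \<open>The bounds for single log-sum-exp functions add up, since the linear part cancels in the increment of
  the gradient and vanishes in the Hessian. By duality of the \<open>l\<^sub>1\<close> and maximum norms,
  \<open>K * lq_norm 1 h\<close> bounds the oscillation of \<open>z s i \<bullet> h\<close> over \<open>i\<close>.\<close>

lemma log_sum_exp_form_bregman:
  fixes a :: "real^'p" and z :: "'s \<Rightarrow> 'i \<Rightarrow> real^'p"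
  assumes T: "finite T" and R: "\<And>s. s \<in> T \<Longrightarrow> finite (R s)" "\<And>s. s \<in> T \<Longrightarrow> R s \<noteq> {}"
    and c: "\<And>s. s \<in> T \<Longrightarrow> 0 \<le> c s"
    and K: "\<And>s i i' j. s \<in> T \<Longrightarrow> i \<in> R s \<Longrightarrow> i' \<in> R s \<Longrightarrow> \<bar>z s i $ j - z s i' $ j\<bar> \<le> K"
    and l: "l = (\<lambda>\<beta>. a \<bullet> \<beta> + (\<Sum>s\<in>T. c s * log_sum_exp (R s) (z s) \<beta>))"
  shows "GDERIV l x :> gradient l x"
    and "0 \<le> h \<bullet> (hessian l x *v h)"
    and "exp (- (K * lq_norm 1 h)) * (h \<bullet> (hessian l x *v h))
           \<le> h \<bullet> (gradient l (x + h) - gradient l x)"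
    and "0 < h \<bullet> (hessian l x *v h) \<Longrightarrow>
         exp (- (K * lq_norm 1 h)) * (h \<bullet> (hessian l x *v h))
           < h \<bullet> (gradient l (x + h) - gradient l x)"
proof -
  define g where "g y = a + (\<Sum>s\<in>T. c s *\<^sub>R softmax_mean (R s) (z s) y)" for y
  have deriv: "GDERIV l y :> g y" for y
  proof -
    have "((\<lambda>\<beta>. a \<bullet> \<beta> + (\<Sum>s\<in>T. c s * log_sum_exp (R s) (z s) \<beta>)) has_derivative
        (\<lambda>h. a \<bullet> h + (\<Sum>s\<in>T. c s * (h \<bullet> softmax_mean (R s) (z s) y)))) (at y)"
      using log_sum_exp_gradient[OF R] unfolding gderiv_def
      by (intro has_derivative_add has_derivative_sum has_derivative_mult_right
          has_derivative_inner_right has_derivative_ident)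
    then show ?thesis
      by (simp add: l gderiv_def g_def inner_add_right inner_sum_right inner_commute[of a])
  qed
  have grad: "gradient l y = g y" for y by (rule gradient_eq[OF deriv])
  show "GDERIV l x :> gradient l x" unfolding grad by (rule deriv)
  have "(g has_derivative (\<lambda>h. 0 + (\<Sum>s\<in>T. c s *\<^sub>R softmax_covariance (R s) (z s) x h))) (at x)"
    unfolding g_def[abs_def] using softmax_mean_derivative[OF R]
    by (intro has_derivative_add has_derivative_const has_derivative_sum has_derivative_scaleR_right)
  then have hess: "hessian l x *v h = (\<Sum>s\<in>T. c s *\<^sub>R softmax_covariance (R s) (z s) x h)"
    using hessian_mult[OF deriv] by simp
  define Q where "Q s = h \<bullet> softmax_covariance (R s) (z s) x h" for s
  define D where "D s = h \<bullet> (softmax_mean (R s) (z s) (x + h) - softmax_mean (R s) (z s) x)" for s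
  have Q: "h \<bullet> (hessian l x *v h) = (\<Sum>s\<in>T. c s * Q s)"
    by (simp add: hess Q_def inner_sum_right)
  have D: "h \<bullet> (gradient l (x + h) - gradient l x) = (\<Sum>s\<in>T. c s * D s)"
    by (simp add: grad g_def D_def inner_sum_right inner_diff_right sum_subtractf
        right_diff_distrib inner_add_right)
  have osc: "\<bar>z s i \<bullet> h - z s i' \<bullet> h\<bar> \<le> K * lq_norm 1 h" if "s \<in> T" "i \<in> R s" "i' \<in> R s" for s i i'
  proof -
    have "\<bar>z s i \<bullet> h - z s i' \<bullet> h\<bar> = \<bar>\<Sum>j\<in>UNIV. (z s i $ j - z s i' $ j) * h $ j\<bar>"
      by (simp add: inner_vec_def sum_subtractf left_diff_distrib)
    also have "\<dots> \<le> (\<Sum>j\<in>UNIV. \<bar>(z s i $ j - z s i' $ j) * h $ j\<bar>)" by (rule sum_abs)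
    also have "\<dots> \<le> (\<Sum>j\<in>UNIV. K * \<bar>h $ j\<bar>)"
      using K[OF that] by (intro sum_mono) (simp add: abs_mult mult_right_mono)
    finally show ?thesis by (simp add: lq_norm_1 sum_distrib_left)
  qed
  let ?e = "exp (- (K * lq_norm 1 h))"
  have lower: "0 \<le> Q s" "?e * Q s \<le> D s" "0 < Q s \<Longrightarrow> ?e * Q s < D s" if "s \<in> T" for s
    unfolding Q_def D_def
    by (rule log_sum_exp_bregman_lower[OF R[OF that] osc[OF that]]; assumption)+
  show "0 \<le> h \<bullet> (hessian l x *v h)"
    unfolding Q using c lower(1) by (intro sum_nonneg) simp
  have distrib: "?e * (\<Sum>s\<in>T. c s * Q s) = (\<Sum>s\<in>T. c s * (?e * Q s))"
    by (simp add: sum_distrib_left mult_ac)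
  show "?e * (h \<bullet> (hessian l x *v h)) \<le> h \<bullet> (gradient l (x + h) - gradient l x)"
    unfolding Q D distrib using c lower(2) by (intro sum_mono mult_left_mono) 
  show "?e * (h \<bullet> (hessian l x *v h)) < h \<bullet> (gradient l (x + h) - gradient l x)"
    if pos: "0 < h \<bullet> (hessian l x *v h)"
  proof -
    obtain s where s: "s \<in> T" "0 < c s * Q s"
      using pos unfolding Q by (meson not_le sum_nonpos)
    then have "0 < c s" "0 < Q s" using c[OF s(1)] by (auto simp: zero_less_mult_iff)
    then have "c s * (?e * Q s) < c s * D s" using lower(3)[OF s(1)] by simp
    then show ?thesis
      unfolding Q D distrib using c lower(2) T s(1)
      by (intro sum_strict_mono_ex1) (auto intro!: mult_left_mono)
  qed
qed

section \<open>The basic inequality of the lasso\<close>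

text \<open>This is the subgradient condition at a minimizer, tested against \<open>\<beta>\<close>. It comes from moving
  from \<open>b\<close> towards \<open>\<beta>\<close>: the penalty grows at most at the rate of its chord, so that \<open>f\<close>
  cannot decrease faster than that.\<close>

lemma lasso_first_order:
  assumes grad: "GDERIV f b :> g" and lam: "0 \<le> lam" and lasso: "lasso_estimator f lam b"
  shows "(b - \<beta>) \<bullet> g \<le> lam * (lq_norm 1 \<beta> - lq_norm 1 b)"
proof -
  let ?h = "\<beta> - b"
  have "((\<lambda>t. b + t *\<^sub>R ?h) has_derivative (\<lambda>t. t *\<^sub>R ?h)) (at 0)"
    by (auto intro!: derivative_eq_intros)
  moreover have "(f has_derivative (\<lambda>h. h \<bullet> g)) (at (b + 0 *\<^sub>R ?h))"
    using grad by (simp add: gderiv_def)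
  ultimately have "((\<lambda>t. f (b + t *\<^sub>R ?h)) has_derivative (\<lambda>t. (t *\<^sub>R ?h) \<bullet> g)) (at 0)"
    by (rule has_derivative_compose)
  then have "((\<lambda>t. f (b + t *\<^sub>R ?h)) has_real_derivative (?h \<bullet> g)) (at 0)"
    by (simp add: has_field_derivative_def mult.commute[of _ "?h \<bullet> g"])
  then have "(\<lambda>t. (f (b + t *\<^sub>R ?h) - f b) / t) \<midarrow>0\<rightarrow> ?h \<bullet> g"
    by (simp add: has_field_derivative_iff)
  then have lim: "((\<lambda>t. (f (b + t *\<^sub>R ?h) - f b) / t) \<longlongrightarrow> ?h \<bullet> g) (at_right 0)"
    by (rule filterlim_mono[OF _ order_refl at_le]) simp
  have "\<forall>\<^sub>F t in at_right 0. t < (1::real)"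
    by (intro order_tendstoD(2)[OF tendsto_ident_at]) auto
  then have "\<forall>\<^sub>F t in at_right 0. - lam * (lq_norm 1 \<beta> - lq_norm 1 b) \<le> (f (b + t *\<^sub>R ?h) - f b) / t"
    using eventually_at_right_less[of 0]
  proof eventually_elim
    case (elim t)
    have "lq_norm 1 (b + t *\<^sub>R ?h) \<le> (\<Sum>j\<in>UNIV. (1 - t) * \<bar>b $ j\<bar> + t * \<bar>\<beta> $ j\<bar>)"
      unfolding lq_norm_1
    proof (rule sum_mono)
      fix j
      have "(b + t *\<^sub>R ?h) $ j = (1 - t) * b $ j + t * \<beta> $ j" by (simp add: algebra_simps)
      then show "\<bar>(b + t *\<^sub>R ?h) $ j\<bar> \<le> (1 - t) * \<bar>b $ j\<bar> + t * \<bar>\<beta> $ j\<bar>"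
        using elim abs_triangle_ineq[of "(1 - t) * b $ j" "t * \<beta> $ j"] by (simp add: abs_mult)
    qed
    also have "\<dots> = lq_norm 1 b + t * (lq_norm 1 \<beta> - lq_norm 1 b)"
      by (simp only: lq_norm_1 sum.distrib sum_distrib_left[symmetric]) (simp add: algebra_simps)
    finally have "lam * lq_norm 1 (b + t *\<^sub>R ?h) \<le> lam * (lq_norm 1 b + t * (lq_norm 1 \<beta> - lq_norm 1 b))"
      using lam by (rule mult_left_mono)
    moreover have "f b + lam * lq_norm 1 b \<le> f (b + t *\<^sub>R ?h) + lam * lq_norm 1 (b + t *\<^sub>R ?h)"
      using lasso by (auto simp: lasso_estimator_def is_arg_min_def not_less)
    ultimately have "- lam * (lq_norm 1 \<beta> - lq_norm 1 b) * t \<le> f (b + t *\<^sub>R ?h) - f b"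
      by (simp add: algebra_simps)
    then show ?case using elim by (simp add: pos_le_divide_eq)
  qed
  then have "- lam * (lq_norm 1 \<beta> - lq_norm 1 b) \<le> ?h \<bullet> g"
    using lim by (intro tendsto_lowerbound[OF lim]) auto
  moreover have "?h \<bullet> g = - ((b - \<beta>) \<bullet> g)" by (simp add: inner_diff_left)
  ultimately show ?thesis by simp
qed

lemma lq_norm_1_split: "lq_norm 1 v = lq_norm 1 (subvec A v) + lq_norm 1 (subvec (- A) v)"
  unfolding lq_norm_1 sum.distrib[symmetric] by (intro sum.cong) (auto simp: subvec_def)

lemma inner_le_lq_norm: "u \<bullet> v \<le> lq_norm 1 u * lq_norm \<infinity> v"
proof -
  have "u \<bullet> v \<le> (\<Sum>j\<in>UNIV. \<bar>u $ j\<bar> * \<bar>v $ j\<bar>)"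
    by (auto simp: inner_vec_def abs_mult[symmetric] intro!: sum_mono)
  also have "\<dots> \<le> (\<Sum>j\<in>UNIV. \<bar>u $ j\<bar> * lq_norm \<infinity> v)"
    by (intro sum_mono mult_left_mono) (auto simp: lq_norm_def intro!: Max_ge)
  finally show ?thesis by (simp add: lq_norm_1 sum_distrib_right)
qed

text \<open>In passing from \<open>\<beta>\<close> to \<open>b\<close>, the penalty grows by the full size of \<open>\<theta>\<close> off the
  support and falls by at most the size of \<open>\<theta>\<close> on it; the gradient at \<open>\<beta>\<close> shifts
  both coefficients by at most \<open>r\<close>.\<close>

lemma lasso_basic_inequality:
  fixes b \<beta> :: "real^'p"
  defines "\<theta> \<equiv> b - \<beta>" and "A \<equiv> support \<beta>"
  assumes grad: "GDERIV f b :> gradient f b" and lam: "0 \<le> lam" and lasso: "lasso_estimator f lam b"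
    and event: "lq_norm \<infinity> (gradient f \<beta>) \<le> r"
  shows "sym_bregman f b \<beta>
    \<le> (lam + r) * lq_norm 1 (subvec A \<theta>) - (lam - r) * lq_norm 1 (subvec (- A) \<theta>)"
proof -
  have "lq_norm 1 \<beta> - lq_norm 1 b = (\<Sum>j\<in>UNIV. \<bar>\<beta> $ j\<bar> - \<bar>b $ j\<bar>)"
    by (simp add: lq_norm_1 sum_subtractf)
  also have "\<dots> \<le> (\<Sum>j\<in>UNIV. \<bar>subvec A \<theta> $ j\<bar> - \<bar>subvec (- A) \<theta> $ j\<bar>)"
    by (intro sum_mono) (auto simp: subvec_def \<theta>_def A_def support_def)
  also have "\<dots> = lq_norm 1 (subvec A \<theta>) - lq_norm 1 (subvec (- A) \<theta>)"
    by (simp add: lq_norm_1 sum_subtractf)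
  finally have "\<theta> \<bullet> gradient f b \<le> lam * (lq_norm 1 (subvec A \<theta>) - lq_norm 1 (subvec (- A) \<theta>))"
    using lasso_first_order[OF grad lam lasso, of \<beta>] lam unfolding \<theta>_def
    by (meson mult_left_mono order_trans)
  moreover have "- (\<theta> \<bullet> gradient f \<beta>) \<le> r * lq_norm 1 \<theta>"
  proof -
    have "0 \<le> lq_norm 1 \<theta>" by (simp add: lq_norm_1 sum_nonneg)
    then have "lq_norm 1 \<theta> * lq_norm \<infinity> (gradient f \<beta>) \<le> lq_norm 1 \<theta> * r"
      using event by (intro mult_left_mono)
    moreover have "lq_norm 1 (- \<theta>) = lq_norm 1 \<theta>" by (simp add: lq_norm_1)
    ultimately show ?thesis using inner_le_lq_norm[of "- \<theta>" "gradient f \<beta>"]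
      by (simp add: mult.commute)
  qed
  ultimately show ?thesis
    unfolding sym_bregman_def \<theta>_def[symmetric] lq_norm_1_split[of \<theta> A]
    by (simp add: inner_diff_right algebra_simps)
qed

section \<open>Oracle inequalities in the cone\<close>

lemma lq_norm_1_nonneg: "0 \<le> lq_norm 1 v"
  by (simp add: lq_norm_1 sum_nonneg)

lemma lq_norm_1_eq_0: "lq_norm 1 v = 0 \<longleftrightarrow> v = 0"
  by (simp add: lq_norm_1 sum_nonneg_eq_0_iff vec_eq_iff)

lemma lq_norm_1_scaleR: "lq_norm 1 (t *\<^sub>R v) = \<bar>t\<bar> * lq_norm 1 v"
  by (simp add: lq_norm_1 abs_mult sum_distrib_left)

lemma lq_norm_pos:
  fixes v :: "real^'p"
  assumes "1 \<le> q" "v \<noteq> 0"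
  shows "0 < lq_norm q v"
proof -
  obtain j where j: "v $ j \<noteq> 0" using assms(2) by (auto simp: vec_eq_iff)
  show ?thesis
  proof (cases "q = \<infinity>")
    case True
    have "\<bar>v $ j\<bar> \<le> Max (range (\<lambda>j. \<bar>v $ j\<bar>))" by (intro Max_ge) auto
    then have "0 < Max (range (\<lambda>j. \<bar>v $ j\<bar>))" using j by linarith
    then show ?thesis using True by (simp add: lq_norm_def)
  next
    case False
    have "0 < (\<Sum>j\<in>UNIV. \<bar>v $ j\<bar> powr real_of_ereal q)"
      using j by (intro sum_pos2[where i = j]) auto
    then show ?thesis using False by (simp add: lq_norm_def)
  qed
qed

lemma lq_norm_0:
  assumes "1 \<le> q"
  shows "lq_norm q (0 :: real^'p) = 0"
  using assms by (cases q) (auto simp: lq_norm_def)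

lemma cone_set_iff: "b \<in> cone_set \<xi> A \<longleftrightarrow> lq_norm 1 (subvec (- A) b) \<le> \<xi> * lq_norm 1 (subvec A b)"
  by (simp add: cone_set_def)

lemma cone_set_nonzero_pos:
  assumes "b \<in> cone_set \<xi> A" "b \<noteq> 0"
  shows "0 < lq_norm 1 (subvec A b)"
proof (rule ccontr)
  assume "\<not> 0 < lq_norm 1 (subvec A b)"
  then have "lq_norm 1 (subvec A b) = 0" using lq_norm_1_nonneg[of "subvec A b"] by linarith
  with assms(1) have "lq_norm 1 b \<le> 0"
    by (simp add: cone_set_iff lq_norm_1_split[of b A])
  then show False using assms(2) lq_norm_1_nonneg[of b] lq_norm_1_eq_0[of b] by linarith
qed

text \<open>Suppose that \<open>\<theta>\<close> is longer than claimed and shorten it to \<open>t *\<^sub>R \<theta>\<close> with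
  \<open>K * lq_norm 1 (t *\<^sub>R \<theta>) = \<eta>\<close>. There the strict lower bound applies with the loss
  factor \<open>exp (- \<eta>)\<close>, and by monotonicity of the gradient the upper bound \<open>basic\<close> is
  inherited from \<open>\<theta>\<close>. Combined with \<open>compat\<close> and \<open>eta\<close> they say
  \<open>((\<xi> + 1) P)\<^sup>2 < 4 (P + Q) (\<xi> P - Q)\<close>, against the inequality of arithmetic and
  geometric means, as the two factors on the right add up to \<open>(\<xi> + 1) P\<close>.\<close>

lemma bregman_radius:
  fixes G :: "real^'p \<Rightarrow> real^'p" and H :: "real^'p^'p"
  assumes mono: "\<And>x h. 0 \<le> h \<bullet> (G (x + h) - G x)"
    and strict: "\<And>h. 0 < h \<bullet> (H *v h) \<Longrightarrow>
      exp (- (K * lq_norm 1 h)) * (h \<bullet> (H *v h)) < h \<bullet> (G (\<beta> + h) - G \<beta>)"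
    and basic: "\<theta> \<bullet> (G (\<beta> + \<theta>) - G \<beta>) \<le> 2 * lam / (\<xi> + 1) * (\<xi> * P - Q)"
    and PQ: "lq_norm 1 \<theta> = P + Q" "0 < P" "0 \<le> Q"
    and compat: "k\<^sup>2 * P\<^sup>2 \<le> d * (\<theta> \<bullet> (H *v \<theta>))"
    and pos: "0 < K" "0 < k" "0 < d" "0 < lam" "0 < \<xi>"
    and eta: "\<eta> * exp (- \<eta>) = K * (\<xi> + 1) * d * lam / (2 * k\<^sup>2)"
  shows "K * lq_norm 1 \<theta> \<le> \<eta>"
proof (rule ccontr)
  assume "\<not> K * lq_norm 1 \<theta> \<le> \<eta>"
  then have x: "\<eta> < K * (P + Q)" by (simp add: PQ)
  define x where "x = P + Q"
  have xpos: "0 < x" using PQ by (simp add: x_def)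
  define q where "q = \<theta> \<bullet> (H *v \<theta>)"
  have "0 < d * q" using compat pos PQ by (intro less_le_trans[OF _ compat[folded q_def]]) simp
  then have q: "0 < q" using pos by (simp add: zero_less_mult_iff)
  have "0 < \<eta> * exp (- \<eta>)" unfolding eta using pos by simp
  then have etapos: "0 < \<eta>" by (simp add: zero_less_mult_iff)
  define t where "t = \<eta> / (K * x)"
  have t: "0 < t" "t < 1" using x xpos pos etapos by (auto simp: t_def x_def)
  have quad: "(t *\<^sub>R \<theta>) \<bullet> (H *v (t *\<^sub>R \<theta>)) = t * (t * q)"
    by (simp add: q_def matrix_vector_mult_scaleR)
  have "K * lq_norm 1 (t *\<^sub>R \<theta>) = \<eta>"
    using t pos xpos by (simp add: lq_norm_1_scaleR PQ(1) x_def[symmetric]) (simp add: t_def)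
  then have "exp (- \<eta>) * (t * (t * q)) < (t *\<^sub>R \<theta>) \<bullet> (G (\<beta> + t *\<^sub>R \<theta>) - G \<beta>)"
    using strict[of "t *\<^sub>R \<theta>"] q t unfolding quad by simp
  then have "t * (exp (- \<eta>) * t * q) < t * (\<theta> \<bullet> (G (\<beta> + t *\<^sub>R \<theta>) - G \<beta>))"
    by (simp add: mult_ac)
  then have 1: "exp (- \<eta>) * t * q < \<theta> \<bullet> (G (\<beta> + t *\<^sub>R \<theta>) - G \<beta>)"
    using t by simp
  have "(\<beta> + t *\<^sub>R \<theta>) + (1 - t) *\<^sub>R \<theta> = \<beta> + \<theta>"
    by (simp add: add.assoc flip: scaleR_add_left)
  then have "0 \<le> (1 - t) * (\<theta> \<bullet> (G (\<beta> + \<theta>) - G (\<beta> + t *\<^sub>R \<theta>)))"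
    using mono[of "(1 - t) *\<^sub>R \<theta>" "\<beta> + t *\<^sub>R \<theta>"] by (simp only: inner_scaleR_left)
  then have "0 \<le> \<theta> \<bullet> (G (\<beta> + \<theta>) - G (\<beta> + t *\<^sub>R \<theta>))"
    using t by (simp add: zero_le_mult_iff)
  then have 2: "exp (- \<eta>) * t * q < 2 * lam / (\<xi> + 1) * (\<xi> * P - Q)"
    using 1 basic by (simp add: inner_diff_right)
  have "exp (- \<eta>) * t * q = (\<eta> * exp (- \<eta>)) * q / (K * x)"
    by (simp add: t_def)
  also have "\<dots> = (\<xi> + 1) * lam / (2 * x * k\<^sup>2) * (d * q)"
    unfolding eta using pos xpos by (simp add: field_simps)
  also have "\<dots> \<ge> (\<xi> + 1) * lam / (2 * x * k\<^sup>2) * (k\<^sup>2 * P\<^sup>2)"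
    using compat pos xpos unfolding q_def by (intro mult_left_mono) auto
  finally have "(\<xi> + 1) * lam / (2 * x * k\<^sup>2) * (k\<^sup>2 * P\<^sup>2) < 2 * lam / (\<xi> + 1) * (\<xi> * P - Q)"
    using 2 by linarith
  then have "lam * ((\<xi> + 1) * P\<^sup>2 / (2 * x)) < lam * (2 * (\<xi> * P - Q) / (\<xi> + 1))"
    using pos by (simp add: mult_ac)
  then have "(\<xi> + 1) * P\<^sup>2 / (2 * x) < 2 * (\<xi> * P - Q) / (\<xi> + 1)"
    using pos by (simp only: mult_less_cancel_left_pos)
  then have "(\<xi> + 1)\<^sup>2 * P\<^sup>2 < 4 * x * (\<xi> * P - Q)"
    using pos xpos by (simp add: field_simps power2_eq_square)
  moreover have "((\<xi> + 1) * P)\<^sup>2 - 4 * x * (\<xi> * P - Q) = (x - (\<xi> * P - Q))\<^sup>2"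
    by (simp add: x_def power2_eq_square algebra_simps)
  ultimately show False by (smt (verit) power_mult_distrib zero_le_power2)
qed

lemma compat_factor_nonneg:
  fixes S :: "real^'p^'p"
  assumes "\<And>h. 0 \<le> h \<bullet> (S *v h)"
  shows "0 \<le> compat_factor \<xi> A S"
  unfolding compat_factor_def using assms
  by (intro INF_greatest) (simp add: lq_norm_1_nonneg)

text \<open>The cone contains the coordinate vectors of \<open>A\<close>, so the infimum is not over the empty set.\<close>

lemma compat_factor_finite:
  fixes S :: "real^'p^'p"
  assumes "A \<noteq> {}" "0 \<le> \<xi>"
  shows "compat_factor \<xi> A S \<noteq> \<infinity>"
proof -
  obtain j where "j \<in> A" using assms(1) by blast
  then have "axis j 1 \<in> {b \<in> cone_set \<xi> A. b \<noteq> 0}"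
    using assms(2) by (auto simp: cone_set_iff lq_norm_1 subvec_def axis_def vec_eq_iff
        intro!: sum_nonpos order_trans[OF sum_nonpos] mult_nonneg_nonneg sum_nonneg)
  then have "compat_factor \<xi> A S \<le> ereal (sqrt (real (card A)) *
      sqrt (axis j 1 \<bullet> (S *v axis j 1)) / lq_norm 1 (subvec A (axis j 1)))"
    unfolding compat_factor_def by (rule INF_lower)
  then show ?thesis by auto
qed

lemma compat_factor_le:
  fixes S :: "real^'p^'p"
  assumes psd: "0 \<le> b \<bullet> (S *v b)" and k: "compat_factor \<xi> A S = ereal k" "0 \<le> k"
    and b: "b \<in> cone_set \<xi> A" "b \<noteq> 0"
  shows "k\<^sup>2 * (lq_norm 1 (subvec A b))\<^sup>2 \<le> real (card A) * (b \<bullet> (S *v b))"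
proof -
  have P: "0 < lq_norm 1 (subvec A b)" by (rule cone_set_nonzero_pos[OF b])
  have "ereal k \<le> ereal (sqrt (real (card A)) * sqrt (b \<bullet> (S *v b)) / lq_norm 1 (subvec A b))"
    unfolding k(1)[symmetric] compat_factor_def using b by (intro INF_lower) auto
  then have "k * lq_norm 1 (subvec A b) \<le> sqrt (real (card A)) * sqrt (b \<bullet> (S *v b))"
    using P by (simp add: pos_le_divide_eq)
  then have "(k * lq_norm 1 (subvec A b))\<^sup>2 \<le> (sqrt (real (card A)) * sqrt (b \<bullet> (S *v b)))\<^sup>2"
    using k(2) P by (intro power_mono) auto
  then show ?thesis using psd by (simp add: power_mult_distrib)
qed

lemma ereal_divide_zero: "0 < r \<Longrightarrow> ereal r / 0 = \<infinity>"
  by (simp add: divide_ereal_def)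

text \<open>For \<open>b \<noteq> 0\<close>, the quotient that defines the factor is, at \<open>b\<close>, at most
  \<open>card A powr (1 / q) * C / lq_norm q b\<close>; solving for the norm gives the claim. A vanishing factor
  makes the right-hand side infinite, since the numerator is positive.\<close>

lemma lq_norm_le_weak_cif:
  fixes S :: "real^'p^'p"
  assumes psd: "\<And>h. 0 \<le> h \<bullet> (S *v h)" and q: "1 \<le> q"
    and b: "b \<in> cone_set \<xi> A" and A: "A \<noteq> {}" and C: "0 < C"
    and bound: "b \<bullet> (S *v b) \<le> C * lq_norm 1 (subvec A b)"
  shows "ereal (lq_norm q b)
    \<le> ereal (C * real (card A) powr real_of_ereal (1 / q)) / weak_cif q \<xi> A S"
proof -
  let ?d = "real (card A) powr real_of_ereal (1 / q)"
  have d: "0 < ?d" using A finite[of A] by (simp add: card_gt_0_iff)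
  have F0: "0 \<le> weak_cif q \<xi> A S"
    unfolding weak_cif_def using psd q
    by (intro INF_greatest) (auto intro!: divide_nonneg_nonneg mult_nonneg_nonneg lq_norm_1_nonneg
        less_imp_le[OF lq_norm_pos])
  show ?thesis
  proof (cases "b = 0")
    case True
    then show ?thesis using q F0 C d by (simp add: lq_norm_0 zero_ereal_def[symmetric])
  next
    case False
    have P: "0 < lq_norm 1 (subvec A b)" by (rule cone_set_nonzero_pos[OF b False])
    have L: "0 < lq_norm q b" by (rule lq_norm_pos[OF q False])
    have "weak_cif q \<xi> A S \<le> ereal (?d * (b \<bullet> (S *v b)) / (lq_norm 1 (subvec A b) * lq_norm q b))"
      unfolding weak_cif_def using b False by (intro INF_lower) auto
    also have "\<dots> \<le> ereal (?d * C / lq_norm q b)"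
    proof -
      have "?d * (b \<bullet> (S *v b)) / (lq_norm 1 (subvec A b) * lq_norm q b)
          \<le> ?d * (C * lq_norm 1 (subvec A b)) / (lq_norm 1 (subvec A b) * lq_norm q b)"
        using bound P L d by (intro divide_right_mono mult_left_mono) auto
      then show ?thesis using P by simp
    qed
    finally have le: "weak_cif q \<xi> A S \<le> ereal (?d * C / lq_norm q b)" .
    then obtain F where F: "weak_cif q \<xi> A S = ereal F" "0 \<le> F" "F \<le> ?d * C / lq_norm q b"
      using F0 by (cases "weak_cif q \<xi> A S") auto
    show ?thesis
    proof (cases "F = 0")
      case True
      then show ?thesis using F(1) ereal_divide_zero[OF mult_pos_pos[OF C d]] by (simp add: zero_ereal_def[symmetric])
    next
      case False
      then have "lq_norm q b \<le> C * ?d / F"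
        using F(2,3) L by (simp add: field_simps)
      then show ?thesis using F False by simp
    qed
  qed
qed

theorem theorem3p1:
  fixes M :: "'w measure" and F :: "real \<Rightarrow> 'w measure" and n :: nat
    and N Y :: "nat \<Rightarrow> real \<Rightarrow> 'w \<Rightarrow> real" and Z :: "nat \<Rightarrow> real \<Rightarrow> 'w \<Rightarrow> real^'p"
    and \<Lambda> :: "nat \<Rightarrow> real \<Rightarrow> 'w \<Rightarrow> real" and \<Lambda>0 :: "real \<Rightarrow> real"
    and \<beta>o \<beta>hat :: "real^'p" and \<xi> lam K \<eta> d\<^sub>o :: real and \<kappa> \<tau> :: ereal
    and l :: "real^'p \<Rightarrow> real" and \<omega> :: 'w
  assumes model: "cox_model M F n N Y Z \<Lambda> \<Lambda>0 \<beta>o"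
    and omega: "\<omega> \<in> space M"
    and l_exists: "neg_log_pl_exists n N Y Z \<omega>"
    and l_def: "l = neg_log_pl n N Y Z \<omega>"
    and xi: "\<xi> > 1"
    and lam: "lam \<ge> 0"
    and lasso: "lasso_estimator l lam \<beta>hat"
    and d_def: "d\<^sub>o = real (card (support \<beta>o))"
    and kappa_def: "\<kappa> = compat_factor \<xi> (support \<beta>o) (hessian l \<beta>o)"
    and K: "K > 0"
    and tau_def: "\<tau> = ereal (K * (\<xi> + 1) * d\<^sub>o * lam) / (2 * \<kappa>^2)"
    and Z_bound: "\<forall>i\<in>{1..n}. \<forall>i'\<in>{1..n}. i < i' \<longrightarrow>
                    (\<forall>t\<ge>0. \<forall>j. \<bar>Z i t \<omega> $ j - Z i' t \<omega> $ j\<bar> \<le> K)"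
    and tau_le: "\<tau> \<le> ereal (1 / exp 1)"
    and eta_le: "\<eta> \<le> 1"
    and eta_sol: "ereal (\<eta> * exp (- \<eta>)) = \<tau>"
    and eta_smaller: "\<forall>x::real. ereal (x * exp (- x)) = \<tau> \<longrightarrow> \<eta> \<le> x"
    and event: "lq_norm \<infinity> (gradient l \<beta>o) \<le> (\<xi> - 1) / (\<xi> + 1) * lam"
  shows "ereal (sym_bregman l \<beta>hat \<beta>o)
           \<le> ereal (4 * exp \<eta> * (1 + 1/\<xi>) powi (-2) * lam^2 * d\<^sub>o) / \<kappa>^2 \<and>
         (lam > 0 \<longrightarrow>
           ereal (lq_norm 1 (\<beta>hat - \<beta>o))
             \<le> ereal (exp \<eta> * (\<xi> + 1) * d\<^sub>o * lam) / (2 * \<kappa>^2) \<and>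
           (\<forall>q::ereal. q \<ge> 1 \<longrightarrow>
             ereal (lq_norm q (\<beta>hat - \<beta>o))
               \<le> ereal (2 * exp \<eta> * (1 + 1/\<xi>) powi (-1) * d\<^sub>o powr real_of_ereal (1 / q) * lam)
                  / weak_cif q \<xi> (support \<beta>o) (hessian l \<beta>o)))"
proof -
  interpret cox_model M F n N Y Z \<Lambda> \<Lambda>0 \<beta>o by (rule model)
  obtain a T c R where form: "finite T" "T \<subseteq> {0..}" "\<And>s. 0 \<le> c s" "\<And>s. R s \<subseteq> {1..n}"
    "\<And>s. s \<in> T \<Longrightarrow> R s \<noteq> {}"
    "neg_log_pl n N Y Z \<omega> = (\<lambda>\<beta>. a \<bullet> \<beta> + (\<Sum>s\<in>T. c s * log_sum_exp (R s) (\<lambda>i. Z i s \<omega>) \<beta>))"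
    by (rule neg_log_pl_eq_log_sum_exp[OF N_counting[OF _ omega] Y_indicator[OF _ _ omega] l_exists])
      auto
  have Z_osc: "\<bar>Z i s \<omega> $ j - Z i' s \<omega> $ j\<bar> \<le> K" if "s \<in> T" "i \<in> R s" "i' \<in> R s" for s i i' j
  proof -
    have "i \<in> {1..n}" "i' \<in> {1..n}" "0 \<le> s" using that form(2) form(4)[of s] by auto
    then have "i < i' \<Longrightarrow> ?thesis" "i' < i \<Longrightarrow> \<bar>Z i' s \<omega> $ j - Z i s \<omega> $ j\<bar> \<le> K"
      using Z_bound by auto
    then show ?thesis
      using K by (cases i i' rule: linorder_cases) (simp_all add: abs_minus_commute)
  qed
  have finR: "finite (R s)" for s using form(4) by (rule finite_subset) simp
  note bregman = log_sum_exp_form_bregman[OF form(1) finR form(5) form(3) Z_osc form(6)[folded l_def]]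
  define H where "H = hessian l \<beta>o"
  have mono: "0 \<le> h \<bullet> (gradient l (x + h) - gradient l x)" for x h
    using bregman(2,3)[of h x] by (meson exp_ge_zero mult_nonneg_nonneg order_trans)
  have psd: "0 \<le> h \<bullet> (H *v h)" for h unfolding H_def by (rule bregman(2))
  define A where "A = support \<beta>o"
  define \<theta> where "\<theta> = \<beta>hat - \<beta>o"
  define P where "P = lq_norm 1 (subvec A \<theta>)"
  define Q where "Q = lq_norm 1 (subvec (- A) \<theta>)"
  define D where "D = sym_bregman l \<beta>hat \<beta>o"
  have PQ: "lq_norm 1 \<theta> = P + Q" "0 \<le> P" "0 \<le> Q"
    by (simp_all add: P_def Q_def lq_norm_1_nonneg lq_norm_1_split[symmetric])
  have D_eq: "D = \<theta> \<bullet> (gradient l (\<beta>o + \<theta>) - gradient l \<beta>o)"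
    by (simp add: D_def \<theta>_def sym_bregman_def)
  have D_nonneg: "0 \<le> D" unfolding D_eq by (rule mono)
  have basic: "D \<le> 2 * lam / (\<xi> + 1) * (\<xi> * P - Q)"
  proof -
    have "D \<le> (lam + (\<xi> - 1) / (\<xi> + 1) * lam) * P - (lam - (\<xi> - 1) / (\<xi> + 1) * lam) * Q"
      using lasso_basic_inequality[OF bregman(1) lam lasso event]
      by (simp add: D_def P_def Q_def A_def \<theta>_def)
    also have "lam + (\<xi> - 1) / (\<xi> + 1) * lam = 2 * lam / (\<xi> + 1) * \<xi>"
      using xi by (simp add: field_simps)
    also have "lam - (\<xi> - 1) / (\<xi> + 1) * lam = 2 * lam / (\<xi> + 1)"
      using xi by (simp add: field_simps)
    also have "2 * lam / (\<xi> + 1) * \<xi> * P - 2 * lam / (\<xi> + 1) * Q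
        = 2 * lam / (\<xi> + 1) * (\<xi> * P - Q)"
      by (simp only: right_diff_distrib mult.assoc)
    finally show ?thesis .
  qed
  have weights: "(1 + 1/\<xi>) powi (-2) = (\<xi> / (\<xi> + 1))\<^sup>2" "(1 + 1/\<xi>) powi (-1) = \<xi> / (\<xi> + 1)"
    using xi by (simp_all add: power_int_minus field_simps)
  show ?thesis
  proof (cases "lam = 0")
    case True
    then show ?thesis using basic D_nonneg by (simp add: D_def zero_ereal_def[symmetric])
  next
    case False
    with lam have lampos: "0 < lam" by simp
    have "0 \<le> 2 * lam / (\<xi> + 1) * (\<xi> * P - Q)" using D_nonneg basic by linarith
    then have "Q \<le> \<xi> * P" using lampos xi by (simp add: zero_le_mult_iff zero_le_divide_iff)
    then have cone: "\<theta> \<in> cone_set \<xi> A" by (simp add: cone_set_iff P_def Q_def)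
    show ?thesis
    proof (cases "A = {}")
      case True
      then have "P = 0" by (simp add: P_def lq_norm_1 subvec_def cong: if_cong)
      with \<open>Q \<le> \<xi> * P\<close> PQ have "\<theta> = 0" using lq_norm_1_eq_0[of \<theta>] by simp
      moreover have "d\<^sub>o = 0" using True by (simp add: d_def A_def)
      moreover have "D = 0" using D_eq \<open>\<theta> = 0\<close> by simp
      ultimately show ?thesis by (simp add: \<theta>_def D_def lq_norm_0 zero_ereal_def[symmetric])
    next
      case False
      then have d: "0 < d\<^sub>o" using finite[of A] by (simp add: d_def A_def card_gt_0_iff)
      have "\<kappa> \<noteq> 0"
      proof
        assume "\<kappa> = 0"
        then have "2 * \<kappa>^2 = 0" by (simp add: power2_eq_square)
        moreover have "0 < K * (\<xi> + 1) * d\<^sub>o * lam" using d K lampos xi by simp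
        ultimately have "\<tau> = \<infinity>" unfolding tau_def by (simp only: ereal_divide_zero)
        then show False using tau_le by simp
      qed
      then obtain k where k: "\<kappa> = ereal k" "0 < k"
        using compat_factor_nonneg[OF psd, of \<xi> A] compat_factor_finite[OF False, of \<xi> H] xi
        unfolding kappa_def H_def A_def
        by (cases "compat_factor \<xi> (support \<beta>o) (hessian l \<beta>o)") auto
      have compat: "k\<^sup>2 * P\<^sup>2 \<le> d\<^sub>o * (\<theta> \<bullet> (H *v \<theta>))"
      proof (cases "\<theta> = 0")
        case True
        then show ?thesis by (simp add: P_def lq_norm_1 subvec_def cong: if_cong)
      next
        case False
        with compat_factor_le[OF psd _ _ cone, of k] k show ?thesis
          by (simp add: d_def kappa_def P_def A_def H_def)
      qed
      have eta: "\<eta> * exp (- \<eta>) = K * (\<xi> + 1) * d\<^sub>o * lam / (2 * k\<^sup>2)"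
        using eta_sol k by (simp add: tau_def numeral_eq_ereal)
      have "0 < \<eta> * exp (- \<eta>)" unfolding eta using K xi d lampos k by simp
      then have etapos: "0 < \<eta>" by (simp add: zero_less_mult_iff)
      have radius: "K * lq_norm 1 \<theta> \<le> \<eta>"
      proof (cases "\<theta> = 0")
        case True
        then show ?thesis using etapos lq_norm_1_eq_0[of \<theta>] by simp
      next
        case False
        then have "0 < P" using cone_set_nonzero_pos[OF cone] by (simp add: P_def)
        then show ?thesis
          using bregman_radius[OF mono bregman(4)[where x = \<beta>o, folded H_def]
              basic[unfolded D_eq] PQ(1) _ PQ(3) compat K k(2) d lampos _ eta] xi by simp
      qed
      have quad: "\<theta> \<bullet> (H *v \<theta>) \<le> exp \<eta> * D"
      proof -
        have "exp (- \<eta>) * (\<theta> \<bullet> (H *v \<theta>)) \<le> exp (- (K * lq_norm 1 \<theta>)) * (\<theta> \<bullet> (H *v \<theta>))"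
          using radius psd by (intro mult_right_mono) auto
        also have "\<dots> \<le> D" using bregman(3)[of \<theta> \<beta>o] by (simp add: D_eq H_def)
        finally show ?thesis by (simp add: exp_minus field_simps)
      qed
      have DP: "D \<le> 2 * lam * \<xi> / (\<xi> + 1) * P"
      proof -
        have "2 * lam / (\<xi> + 1) * (\<xi> * P - Q) \<le> 2 * lam / (\<xi> + 1) * (\<xi> * P)"
          using PQ xi lampos by (intro mult_left_mono) auto
        then show ?thesis using basic by simp
      qed
      have "D \<le> 4 * exp \<eta> * (\<xi> / (\<xi> + 1))\<^sup>2 * lam\<^sup>2 * d\<^sub>o / k\<^sup>2"
      proof (cases "D = 0")
        case True
        then show ?thesis using d by simp
      next
        case False
        \<comment> \<open>\<open>D\<close> is at most linear in \<open>P\<close>, and \<open>P\<^sup>2\<close> at most linear in \<open>D\<close>; hence \<open>D\<^sup>2\<close> is at most linear in \<open>D\<close>, and one factor \<open>D\<close> cancels.\<close>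
        have "D * D * k\<^sup>2 \<le> (2 * lam * \<xi> / (\<xi> + 1) * P)\<^sup>2 * k\<^sup>2"
          using DP D_nonneg unfolding power2_eq_square[of "_ * P"]
          by (intro mult_right_mono mult_mono) auto
        also have "\<dots> = (2 * lam * \<xi> / (\<xi> + 1))\<^sup>2 * (k\<^sup>2 * P\<^sup>2)"
          by (simp only: power_mult_distrib mult_ac)
        also have "\<dots> \<le> (2 * lam * \<xi> / (\<xi> + 1))\<^sup>2 * (d\<^sub>o * (exp \<eta> * D))"
          using compat quad d by (intro mult_left_mono) (auto intro: order_trans mult_left_mono)
        also have "\<dots> = D * (4 * exp \<eta> * (\<xi> / (\<xi> + 1))\<^sup>2 * lam\<^sup>2 * d\<^sub>o)"
          by (simp add: power_mult_distrib power_divide)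
        finally have "D * (D * k\<^sup>2) \<le> D * (4 * exp \<eta> * (\<xi> / (\<xi> + 1))\<^sup>2 * lam\<^sup>2 * d\<^sub>o)"
          by (simp only: mult.assoc)
        then have "D * k\<^sup>2 \<le> 4 * exp \<eta> * (\<xi> / (\<xi> + 1))\<^sup>2 * lam\<^sup>2 * d\<^sub>o"
          by (rule mult_left_le_imp_le) (use False D_nonneg in simp)
        then show ?thesis using k(2) by (simp add: pos_le_divide_eq)
      qed
      moreover have "lq_norm 1 \<theta> \<le> exp \<eta> * (\<xi> + 1) * d\<^sub>o * lam / (2 * k\<^sup>2)"
      proof -
        have "\<eta> = exp \<eta> * (\<eta> * exp (- \<eta>))" by (simp add: exp_minus)
        also have "\<dots> = K * (exp \<eta> * (\<xi> + 1) * d\<^sub>o * lam / (2 * k\<^sup>2))"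
          unfolding eta by simp
        finally show ?thesis using radius K by (metis mult_le_cancel_left_pos)
      qed
      moreover have "ereal (lq_norm q \<theta>)
          \<le> ereal (2 * exp \<eta> * (\<xi> / (\<xi> + 1)) * d\<^sub>o powr real_of_ereal (1 / q) * lam) / weak_cif q \<xi> A H"
        if "1 \<le> q" for q
      proof -
        let ?C = "exp \<eta> * (2 * lam * \<xi> / (\<xi> + 1))"
        have "\<theta> \<bullet> (H *v \<theta>) \<le> ?C * lq_norm 1 (subvec A \<theta>)"
        proof -
          have "exp \<eta> * D \<le> exp \<eta> * (2 * lam * \<xi> / (\<xi> + 1) * P)"
            using DP by (intro mult_left_mono) auto
          then show ?thesis using quad by (simp add: P_def)
        qed
        moreover have "0 < ?C" using xi lampos by simp
        ultimately have "ereal (lq_norm q \<theta>)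
            \<le> ereal (?C * real (card A) powr real_of_ereal (1 / q)) / weak_cif q \<xi> A H"
          using lq_norm_le_weak_cif[OF psd that cone False] by blast
        also have "?C * real (card A) powr real_of_ereal (1 / q)
            = 2 * exp \<eta> * (\<xi> / (\<xi> + 1)) * d\<^sub>o powr real_of_ereal (1 / q) * lam"
          by (simp add: d_def A_def)
        finally show ?thesis .
      qed
      ultimately show ?thesis
        using k unfolding weights
        by (simp add: D_def \<theta>_def A_def H_def numeral_eq_ereal)
    qed
  qed
qed

end
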